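(* Let $d<\infty$ be a positive integer, $r_1,\dots,r_d<\infty$, and $\mathcal{X}=\{(i_1,\dots,i_d)^T: i_j=1,\dots,r_j,\ j=1,\dots,d\}$ with the $d$-monotone order: $\boldsymbol{x}_1\preceq\boldsymbol{x}_2$ iff $x_{1,j}\le x_{2,j}$ for all $j=1,\dots,d$. Let $\mathring{g}:\mathcal{X}\to\mathbb{R}$ be isotonic ($d$-monotone), and suppose that $$Y_i=\mathring{g}(\boldsymbol{x}_i)+\varepsilon_i,\qquad i=1,\dots,n,$$ where the $\boldsymbol{x}_i\in\mathcal{X}$ are deterministic design points and $(\varepsilon_i)$ is a sequence of identically distributed random variables with $\mathbb{E}[\varepsilon_i]=0$ and $\mathrm{Var}[\varepsilon_i]=\sigma^2<\infty$. Let $w^{(n)}_{\boldsymbol{x}}=\frac1n\sum_{i=1}^n1\{\boldsymbol{x}_i=\boldsymbol{x}\}$ and suppose that the design points satisfy $\boldsymbol{w}^{(n)}=(w^{(n)}_{\boldsymbol{x}})_{\boldsymbol{x}\in\mathcal{X}}\to\boldsymbol{w}$ as $n\to\infty$, where $\boldsymbol{w}$ has strictly positive components. Let $$\hat{g}_n(\boldsymbol{x})=\frac{\sum_{i=1}^nY_i1\{\boldsymbol{x}_i=\boldsymbol{x}\}}{\sum_{i=1}^n1\{\boldsymbol{x}_i=\boldsymbol{x}\}},\qquad \hat{g}_n^{*}=\underset{f}{\mathrm{argmin}}\sum_{\boldsymbol{x}\in\mathcal{X}}(f(\boldsymbol{x})-\hat{g}_n(\boldsymbol{x}))^2w^{(n)}_{\boldsymbol{x}},$$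 the minimum being over all isotonic functions $f$ on $\mathcal{X}$ (so $\hat g_n^*$ is the least squares estimator of $\mathring g$ under $d$-monotone constraints). Then $$n^{1/2}(\hat{\boldsymbol{g}}_n^{*}-\mathring{\boldsymbol{g}})\stackrel{d}{\to}\varphi^{\boldsymbol{w}}(\boldsymbol{Y}_{\boldsymbol{0},\Sigma}),$$ where $\boldsymbol{Y}_{\boldsymbol{0},\Sigma}$ is a Gaussian vector with mean zero and diagonal covariance matrix $\Sigma$ whose diagonal elements are $\Sigma_{ii}=\sigma^2w_i$, with $i$ indexing the points of $\mathcal{X}$, and $\varphi^{\boldsymbol{w}}$ maps a vector $\boldsymbol{\theta}$ indexed by $\mathcal{X}$ to the concatenation of the separate isotonic regressions with weights $\boldsymbol{w}$ of the restrictions of $\boldsymbol{\theta}$ to the comparable level sets of $\mathring{g}$.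
   Context: A bold symbol denotes the vector of values of the corresponding function on $\mathcal{X}$. Two elements $x,y$ are comparable if $x\preceq y$ or $y\preceq x$. A function $f$ on $A\subseteq\mathcal{X}$ is isotonic if $x,y\in A$, $x\preceq y$ imply $f(x)\le f(y)$. The isotonic regression of $\theta$ over $A\subseteq\mathcal{X}$ with positive weights $\boldsymbol{w}$ is the (unique) minimizer of $\sum_{x\in A}(f(x)-\theta(x))^2w_x$ over isotonic functions $f$ on $A$. Comparable level sets of $\mathring{g}$: take the level sets $\{x\in\mathcal{X}:\mathring{g}(x)=c\}$ and partition each of them into the connected components of the graph whose vertices are the elements of the level set and whose edges join comparable elements. These components partition $\mathcal{X}$. Operator $\varphi^{\boldsymbol{w}}$: $\varphi^{\boldsymbol{w}}(\boldsymbol{\theta})_{x}$ is the value at $x$ of the isotonic regression with weights $\boldsymbol{w}$, over the comparable level set containing $x$, of the restriction of $\theta$ to that set.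
   Formalization: The errors ε_i are additionally assumed independent (identically distributed alone is not enough), and the diagonal elements of Σ are corrected from σ²w_i to σ²/w_i, since with either as printed the limit claim fails. *)

theory Defs
  imports "HOL-Probability.Probability"
begin

definition grid :: "nat ^ 'd \<Rightarrow> (nat ^ 'd) set" where
  "grid r = {x. \<forall>j. x $ j \<in> {1..r $ j}}"

text \<open>Functions on \<open>A\<close> are represented by their extensional extensions, so that the minimizer
  is unique when the weights are positive on a finite \<open>A\<close>; only the values of \<open>\<theta>\<close> and \<open>w\<close> on
  \<open>A\<close> matter.\<close>

definition isotonic_regression ::
    "'a::order set \<Rightarrow> ('a \<Rightarrow> real) \<Rightarrow> ('a \<Rightarrow> real) \<Rightarrow> 'a \<Rightarrow> real" where
  "isotonic_regression A w \<theta> =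
     arg_min (\<lambda>f. \<Sum>x\<in>A. (f x - \<theta> x)\<^sup>2 * w x) (\<lambda>f. f \<in> extensional A \<and> mono_on A f)"

definition comparability_graph :: "'a::order set \<Rightarrow> ('a \<times> 'a) set" where
  "comparability_graph A = {(x, y). x \<in> A \<and> y \<in> A \<and> (x \<le> y \<or> y \<le> x)}"

definition comparable_level_set :: "'a::order set \<Rightarrow> ('a \<Rightarrow> real) \<Rightarrow> 'a \<Rightarrow> 'a set" where
  "comparable_level_set X g x =
     {y. (x, y) \<in> (comparability_graph {z \<in> X. g z = g x})\<^sup>*}"

definition isotonic_on_level_sets ::
    "'a::order set \<Rightarrow> ('a \<Rightarrow> real) \<Rightarrow> ('a \<Rightarrow> real) \<Rightarrow> ('a \<Rightarrow> real) \<Rightarrow> 'a \<Rightarrow> real" where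
  "isotonic_on_level_sets X g w \<theta> =
     (\<lambda>x\<in>X. isotonic_regression (comparable_level_set X g x) w \<theta> x)"

definition design_weight :: "(nat \<Rightarrow> 'a) \<Rightarrow> nat \<Rightarrow> 'a \<Rightarrow> real" where
  "design_weight xs n x = (\<Sum>i=1..n. indicator {x} (xs i)) / real n"

definition cell_mean :: "(nat \<Rightarrow> 'a) \<Rightarrow> (nat \<Rightarrow> real) \<Rightarrow> nat \<Rightarrow> 'a \<Rightarrow> real" where
  "cell_mean xs y n x =
     (\<Sum>i=1..n. y i * indicator {x} (xs i)) / (\<Sum>i=1..n. indicator {x} (xs i))"

text \<open>The normal law with mean \<open>m\<close> and variance \<open>v \<ge> 0\<close>, degenerate for \<open>v = 0\<close>.\<close>

definition normal_law :: "real \<Rightarrow> real \<Rightarrow> real measure" where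
  "normal_law m v =
     (if v = 0 then return borel m else density lborel (normal_density m (sqrt v)))"

text \<open>\<open>G\<close> is a Gaussian vector indexed by the finite set \<open>I\<close>, with mean \<open>m\<close> and covariance \<open>S\<close>:
  every linear combination of its components is normal, with the corresponding mean and
  variance. Degenerate covariances are allowed.\<close>

definition gaussian_vector ::
    "'v measure \<Rightarrow> 'i set \<Rightarrow> ('i \<Rightarrow> real) \<Rightarrow> ('i \<Rightarrow> 'i \<Rightarrow> real) \<Rightarrow> ('v \<Rightarrow> 'i \<Rightarrow> real) \<Rightarrow> bool" where
  "gaussian_vector N I m S G \<longleftrightarrow>
     prob_space N \<and> G \<in> N \<rightarrow>\<^sub>M (\<Pi>\<^sub>M i\<in>I. borel) \<and>
     (\<forall>a. distr N borel (\<lambda>\<omega>. \<Sum>i\<in>I. a i * G \<omega> i) =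
          normal_law (\<Sum>i\<in>I. a i * m i) (\<Sum>i\<in>I. \<Sum>j\<in>I. a i * a j * S i j))"

text \<open>The covariance of the limit of \<open>sqrt n * (cell_mean - g)\<close>. A cell mean at \<open>x\<close> averages
  about \<open>n * w x\<close> independent errors of variance \<open>\<sigma>\<^sup>2\<close>, so its variance is asymptotically
  \<open>\<sigma>\<^sup>2 / (n * w x)\<close>. The source prints the diagonal entries as \<open>\<sigma>\<^sup>2 * w x\<close>, with which the
  limit theorem fails.\<close>

definition limit_covariance :: "real \<Rightarrow> ('a \<Rightarrow> real) \<Rightarrow> 'a \<Rightarrow> 'a \<Rightarrow> real" where
  "limit_covariance \<sigma> w x y = (if x = y then \<sigma>\<^sup>2 / w x else 0)"

text \<open>Convergence in distribution of random vectors indexed by the finite set \<open>I\<close>, tested on the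
  bounded continuous functions. Measurability of \<open>Z n\<close> is only required for large \<open>n\<close>: an
  estimator need not be well defined before every point of the domain has been observed.\<close>

definition converges_in_distribution ::
    "'i set \<Rightarrow> 'w measure \<Rightarrow> (nat \<Rightarrow> 'w \<Rightarrow> 'i \<Rightarrow> real) \<Rightarrow> 'v measure \<Rightarrow> ('v \<Rightarrow> 'i \<Rightarrow> real) \<Rightarrow> bool"
  where
  "converges_in_distribution I M Z N Z' \<longleftrightarrow>
     (\<forall>\<^sub>F n in sequentially. Z n \<in> M \<rightarrow>\<^sub>M (\<Pi>\<^sub>M i\<in>I. borel)) \<and>
     Z' \<in> N \<rightarrow>\<^sub>M (\<Pi>\<^sub>M i\<in>I. borel) \<and>
     (\<forall>f :: ('i \<Rightarrow> real) \<Rightarrow> real.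
        continuous_map (product_topology (\<lambda>_. euclideanreal) I) euclideanreal f \<and>
        bounded (f ` (\<Pi>\<^sub>E i\<in>I. UNIV)) \<longrightarrow>
        (\<lambda>n. \<integral>\<omega>. f (Z n \<omega>) \<partial>M) \<longlonglongrightarrow> (\<integral>\<omega>. f (Z' \<omega>) \<partial>N))"

end

theory Submission
  imports Defs
begin

text \<open>Isotonic regression is the projection onto a closed convex cone, so by the variational
  inequality it is unique and depends continuously on weights and data. For data within
  \<open>O(1 / sqrt n)\<close> of \<open>g\<close> and large \<open>n\<close>, the constraints between different level sets of \<open>g\<close>
  are slack and the regression splits into those over the comparable level sets; hence the
  rescaled estimator is a function of the rescaled cell errors that converges along convergent
  sequences. Skorohod's theorem, applied to the central limit theorem for the errors, gives on
  a finite power of one probability space copies of the rescaled cell errors that converge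
  pointwise, and dominated convergence finishes the proof. That the copies, and the limit, have
  the right joint laws follows from uniqueness of multivariate characteristic functions.\<close>

section \<open>Isotonic regression\<close>

text \<open>The map from rescaled cell errors to rescaled estimator changes with n, so weak
  convergence of the errors cannot be pushed through one fixed continuous map; this is what calls
  for pointwise convergent copies. A one-dimensional coupling is enough: different cells collect
  disjoint groups of independent errors, so a product space with one coordinate per point of
  \<open>X\<close> reproduces the joint law. On the coordinate of \<open>x\<close> the copy is
  indexed by the number of observations made at \<open>x\<close> rather than by n. The ratio of that
  number to n tends to \<open>w x\<close>, which produces the factor \<open>sqrt (1 / w x)\<close>
  in the limit and hence the variance \<open>\<sigma>\<^sup>2 / w x\<close>.\<close>

lemma isotonic_regression_exists:
  fixes A :: "'a::order set" and w \<theta> :: "'a \<Rightarrow> real"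
  assumes A: "finite A" and w: "\<And>x. x \<in> A \<Longrightarrow> w x > 0"
  shows "\<exists>p. is_arg_min (\<lambda>f. \<Sum>x\<in>A. (f x - \<theta> x)\<^sup>2 * w x) (\<lambda>f. f \<in> extensional A \<and> mono_on A f) p"
proof -
  define L where "L f = (\<Sum>x\<in>A. (f x - \<theta> x)\<^sup>2 * w x)" for f
  define z :: "'a \<Rightarrow> real" where "z = (\<lambda>x\<in>A. 0)"
  \<comment> \<open>A function with \<open>L f \<le> L z\<close> has
    \<open>(f x - \<theta> x)\<^sup>2 * w x \<le> L z\<close> at each \<open>x\<close>, hence stays
    within \<open>B x\<close>; competitors leaving the box are worse than the zero function
    \<open>z\<close>.\<close>
  define B where "B x = \<bar>\<theta> x\<bar> + sqrt (L z / w x)" for x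
  \<comment> \<open>The singleton off \<open>A\<close> encodes extensionality and keeps the box
    compact in the space of total functions, even over an infinite type.\<close>
  define S where "S x = (if x \<in> A then {- B x .. B x} else {undefined})" for x
  define K where "K = Pi UNIV S \<inter> {f. \<forall>x\<in>A. \<forall>y\<in>A. x \<le> y \<longrightarrow> f x \<le> f y}"
  have Lz: "L z \<ge> 0"
    unfolding L_def by (intro sum_nonneg mult_nonneg_nonneg) (auto intro: less_imp_le w)
  have "compactin (product_topology (\<lambda>_. euclidean) UNIV) (Pi\<^sub>E UNIV S)"
    by (subst compactin_PiE) (auto simp: S_def)
  hence "compact (Pi UNIV S)"
    by (simp add: euclidean_product_topology PiE_UNIV_domain)
  moreover have "closed {f::'a \<Rightarrow> real. \<forall>x\<in>A. \<forall>y\<in>A. x \<le> y \<longrightarrow> f x \<le> f y}"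
    unfolding Ball_def
    by (intro closed_Collect_all closed_Collect_imp closed_Collect_le open_Collect_const) auto
  ultimately have "compact K"
    unfolding K_def by (rule compact_Int_closed)
  moreover have "z \<in> K"
  proof -
    have "B x \<ge> 0" if "x \<in> A" for x
      unfolding B_def using Lz w[OF that] by simp
    thus ?thesis by (auto simp: K_def S_def z_def)
  qed
  moreover have "continuous_on K L"
    unfolding L_def by (intro continuous_intros continuous_on_subset[OF continuous_on_product_coordinates]) auto
  ultimately obtain p where p: "p \<in> K" "\<And>q. q \<in> K \<Longrightarrow> L p \<le> L q"
    using continuous_attains_inf[of K L] by blast
  have "L p \<le> L q" if q: "q \<in> extensional A" "mono_on A q" for q
  proof (cases "L q \<le> L z")
    case True
    have "\<bar>q x\<bar> \<le> B x" if x: "x \<in> A" for x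
    proof -
      have "(q x - \<theta> x)\<^sup>2 * w x \<le> L q"
        unfolding L_def using x A w by (intro member_le_sum) (auto simp: less_imp_le)
      hence "(q x - \<theta> x)\<^sup>2 \<le> L z / w x"
        using True w[OF x] by (simp add: field_simps)
      hence "\<bar>q x - \<theta> x\<bar> \<le> sqrt (L z / w x)"
        by (intro real_le_rsqrt) simp
      thus ?thesis by (simp add: B_def)
    qed
    hence "q \<in> K"
      using q by (auto simp: K_def S_def extensional_def abs_le_iff mono_on_def minus_le_iff)
    thus ?thesis by (rule p)
  next
    case False
    thus ?thesis using p(2)[OF \<open>z \<in> K\<close>] by simp
  qed
  moreover have "p \<in> extensional A"
    using p(1) by (fastforce simp: K_def S_def extensional_def Pi_iff split: if_splits)
  moreover have "mono_on A p"
    using p(1) by (auto simp: K_def mono_on_def)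
  ultimately show ?thesis
    unfolding is_arg_min_def L_def[symmetric] by (meson not_le)
qed

text \<open>The competitor \<open>q\<close> may be arbitrary off \<open>A\<close>: the objective
  reads only values on \<open>A\<close>, so \<open>q\<close> can be replaced by its
  restriction.\<close>

lemma
  fixes A :: "'a::order set"
  assumes "finite A" and "\<And>x. x \<in> A \<Longrightarrow> w x > 0"
  shows mono_on_isotonic_regression: "mono_on A (isotonic_regression A w \<theta>)"
    and isotonic_regression_minimizes:
      "mono_on A q \<Longrightarrow>
        (\<Sum>x\<in>A. (isotonic_regression A w \<theta> x - \<theta> x)\<^sup>2 * w x) \<le> (\<Sum>x\<in>A. (q x - \<theta> x)\<^sup>2 * w x)"
proof -
  have *: "is_arg_min (\<lambda>f. \<Sum>x\<in>A. (f x - \<theta> x)\<^sup>2 * w x)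
      (\<lambda>f. f \<in> extensional A \<and> mono_on A f) (isotonic_regression A w \<theta>)"
    unfolding isotonic_regression_def arg_min_def
    by (rule someI_ex[OF isotonic_regression_exists[OF assms]])
  thus "mono_on A (isotonic_regression A w \<theta>)"
    by (simp add: is_arg_min_def)
  assume q: "mono_on A q"
  have "restrict q A \<in> extensional A \<and> mono_on A (restrict q A)"
    using q by (auto simp: mono_on_def)
  hence "(\<Sum>x\<in>A. (isotonic_regression A w \<theta> x - \<theta> x)\<^sup>2 * w x)
      \<le> (\<Sum>x\<in>A. (restrict q A x - \<theta> x)\<^sup>2 * w x)"
    using * unfolding is_arg_min_def by (meson not_le)
  also have "\<dots> = (\<Sum>x\<in>A. (q x - \<theta> x)\<^sup>2 * w x)" by simp
  finally show "(\<Sum>x\<in>A. (isotonic_regression A w \<theta> x - \<theta> x)\<^sup>2 * w x)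
      \<le> (\<Sum>x\<in>A. (q x - \<theta> x)\<^sup>2 * w x)" .
qed

text \<open>First-order optimality over a convex set: comparing \<open>p\<close> with the point
  \<open>(1 - t) * p + t * q\<close> of the segment gives \<open>2 * b \<le> t * c\<close>, and t
  tends to 0 from the right.\<close>

lemma isotonic_minimizer_variational:
  fixes p q \<theta> w :: "'a::order \<Rightarrow> real"
  assumes p: "mono_on A p" and q: "mono_on A q"
    and min: "\<And>f. mono_on A f \<Longrightarrow> (\<Sum>x\<in>A. (p x - \<theta> x)\<^sup>2 * w x) \<le> (\<Sum>x\<in>A. (f x - \<theta> x)\<^sup>2 * w x)"
  shows "(\<Sum>x\<in>A. w x * (\<theta> x - p x) * (q x - p x)) \<le> 0"
proof -
  define b where "b = (\<Sum>x\<in>A. w x * (\<theta> x - p x) * (q x - p x))"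
  define c where "c = (\<Sum>x\<in>A. w x * (q x - p x)\<^sup>2)"
  have "2 * b \<le> t * c" if t: "0 < t" "t < 1" for t
  proof -
    define f where "f x = (1 - t) * p x + t * q x" for x
    have "mono_on A f"
      using p q t unfolding f_def mono_on_def by (auto intro!: add_mono mult_left_mono)
    from min[OF this] have "0 \<le> (\<Sum>x\<in>A. (f x - \<theta> x)\<^sup>2 * w x) - (\<Sum>x\<in>A. (p x - \<theta> x)\<^sup>2 * w x)"
      by simp
    also have "\<dots> = t * (t * c - 2 * b)"
      unfolding sum_subtractf[symmetric] b_def c_def sum_distrib_left f_def
      by (intro sum.cong) (auto simp: power2_eq_square algebra_simps)
    finally show ?thesis using t by (simp add: zero_le_mult_iff)
  qed
  hence "eventually (\<lambda>t. 2 * b \<le> t * c) (at_right 0)"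
    unfolding eventually_at_right_field by (intro exI[of _ 1]) auto
  moreover have "((\<lambda>t. t * c) \<longlongrightarrow> 0 * c) (at_right 0)"
    by (intro tendsto_intros)
  ultimately have "2 * b \<le> 0 * c"
    by (intro tendsto_lowerbound[of _ _ "at_right 0"]) auto
  thus ?thesis by (simp add: b_def)
qed

text \<open>Adding the variational inequalities of the two minimizers gives
  \<open>\<Sum> w' e\<^sup>2 \<le> \<Sum> e d\<close>, where \<open>e = p' - p\<close> and \<open>d\<^sup>2\<close> is the summand on the right-hand side.\<close>

lemma isotonic_minimizer_stable:
  fixes p p' \<theta> \<theta>' w w' :: "'a::order \<Rightarrow> real"
  assumes p: "mono_on A p"
    and min: "\<And>f. mono_on A f \<Longrightarrow> (\<Sum>x\<in>A. (p x - \<theta> x)\<^sup>2 * w x) \<le> (\<Sum>x\<in>A. (f x - \<theta> x)\<^sup>2 * w x)"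
    and p': "mono_on A p'"
    and min': "\<And>f. mono_on A f \<Longrightarrow> (\<Sum>x\<in>A. (p' x - \<theta>' x)\<^sup>2 * w' x) \<le> (\<Sum>x\<in>A. (f x - \<theta>' x)\<^sup>2 * w' x)"
    and c: "c > 0" "\<And>x. x \<in> A \<Longrightarrow> c \<le> w' x"
  shows "c\<^sup>2 * (\<Sum>x\<in>A. (p' x - p x)\<^sup>2) \<le> (\<Sum>x\<in>A. (w' x * (\<theta>' x - p x) - w x * (\<theta> x - p x))\<^sup>2)"
proof -
  define d where "d x = w' x * (\<theta>' x - p x) - w x * (\<theta> x - p x)" for x
  have "(\<Sum>x\<in>A. c * (p' x - p x)\<^sup>2) \<le> (\<Sum>x\<in>A. w' x * (p' x - p x)\<^sup>2)"
    using c by (intro sum_mono mult_right_mono) auto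
  also have "\<dots> = (\<Sum>x\<in>A. w x * (\<theta> x - p x) * (p' x - p x)) + (\<Sum>x\<in>A. w' x * (\<theta>' x - p' x) * (p x - p' x))
      + (\<Sum>x\<in>A. (p' x - p x) * d x)"
    unfolding sum.distrib[symmetric] d_def
    by (intro sum.cong) (auto simp: power2_eq_square algebra_simps)
  also have "\<dots> \<le> (\<Sum>x\<in>A. (p' x - p x) * d x)"
    using isotonic_minimizer_variational[OF p p' min] isotonic_minimizer_variational[OF p' p min']
    by simp
  \<comment> \<open>Young's inequality with parameter \<open>c\<close>: the quadratic term absorbs
    half of the left-hand side and leaves the other half.\<close>
  also have "\<dots> \<le> (\<Sum>x\<in>A. c / 2 * (p' x - p x)\<^sup>2 + (d x)\<^sup>2 / (2 * c))"
  proof (rule sum_mono)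
    fix x
    have "0 \<le> (c * (p' x - p x) - d x)\<^sup>2" by simp
    thus "(p' x - p x) * d x \<le> c / 2 * (p' x - p x)\<^sup>2 + (d x)\<^sup>2 / (2 * c)"
      using c(1) by (simp add: field_simps power2_eq_square)
  qed
  also have "\<dots> = c / 2 * (\<Sum>x\<in>A. (p' x - p x)\<^sup>2) + (\<Sum>x\<in>A. (d x)\<^sup>2) / (2 * c)"
    by (simp add: sum.distrib sum_distrib_left sum_divide_distrib)
  finally have "c / 2 * (\<Sum>x\<in>A. (p' x - p x)\<^sup>2) \<le> (\<Sum>x\<in>A. (d x)\<^sup>2) / (2 * c)"
    by (simp add: sum_distrib_left[symmetric])
  hence "c\<^sup>2 * (\<Sum>x\<in>A. (p' x - p x)\<^sup>2) \<le> (\<Sum>x\<in>A. (d x)\<^sup>2)"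
    using c(1) by (simp add: field_simps power2_eq_square)
  thus ?thesis by (simp add: d_def)
qed

text \<open>Uniqueness: with equal weights and equal data the right-hand side of the stability
  estimate is 0. Since \<open>p\<close> need not be extensional, agreement is claimed on
  \<open>A\<close> only.\<close>

lemma isotonic_regression_eqI:
  fixes A :: "'a::order set"
  assumes A: "finite A" and w: "\<And>x. x \<in> A \<Longrightarrow> w x > 0"
    and p: "mono_on A p"
    and min: "\<And>f. mono_on A f \<Longrightarrow> (\<Sum>x\<in>A. (p x - \<theta> x)\<^sup>2 * w x) \<le> (\<Sum>x\<in>A. (f x - \<theta> x)\<^sup>2 * w x)"
    and x: "x \<in> A"
  shows "isotonic_regression A w \<theta> x = p x"
proof -
  let ?p = "isotonic_regression A w \<theta>"
  define c where "c = Min (w ` A)"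
  have c: "c > 0" "\<And>x. x \<in> A \<Longrightarrow> c \<le> w x"
    using A w x by (auto simp: c_def intro: Min_gr_iff[THEN iffD2])
  have "c\<^sup>2 * (\<Sum>x\<in>A. (?p x - p x)\<^sup>2)
      \<le> (\<Sum>x\<in>A. (w x * (\<theta> x - p x) - w x * (\<theta> x - p x))\<^sup>2)"
    using p min mono_on_isotonic_regression[OF A w] isotonic_regression_minimizes[OF A w] c
    by (rule isotonic_minimizer_stable)
  hence "(\<Sum>x\<in>A. (?p x - p x)\<^sup>2) \<le> 0"
    using c(1) by (simp add: mult_le_0_iff)
  hence "(\<Sum>x\<in>A. (?p x - p x)\<^sup>2) = 0"
    by (intro antisym sum_nonneg) auto
  thus ?thesis using A x by (simp add: sum_nonneg_eq_0_iff)
qed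

lemma isotonic_regression_cong:
  assumes "A = B" and "\<And>x. x \<in> B \<Longrightarrow> w x = w' x" and "\<And>x. x \<in> B \<Longrightarrow> \<theta> x = \<theta>' x"
  shows "isotonic_regression A w \<theta> = isotonic_regression B w' \<theta>'"
proof -
  have "(\<lambda>f. \<Sum>x\<in>A. (f x - \<theta> x)\<^sup>2 * w x) = (\<lambda>f. \<Sum>x\<in>B. (f x - \<theta>' x)\<^sup>2 * w' x)"
    using assms by (intro ext sum.cong) auto
  thus ?thesis by (simp add: isotonic_regression_def assms(1))
qed

text \<open>The limit problem takes the unprimed role in the stability estimate. Its right-hand side
  \<open>D n\<close> then involves the fixed minimizer \<open>p\<close> but not \<open>pn n\<close>,
  so it tends to 0 without any a priori bound on \<open>pn n\<close>.\<close>

lemma tendsto_isotonic_regression: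
  fixes A :: "'a::order set"
  assumes A: "finite A" and w: "\<And>x. x \<in> A \<Longrightarrow> w x > 0"
    and wn: "\<And>x. x \<in> A \<Longrightarrow> ((\<lambda>n. wn n x) \<longlongrightarrow> w x) F"
    and \<theta>n: "\<And>x. x \<in> A \<Longrightarrow> ((\<lambda>n. \<theta>n n x) \<longlongrightarrow> \<theta> x) F"
    and x: "x \<in> A"
  shows "((\<lambda>n. isotonic_regression A (wn n) (\<theta>n n) x) \<longlongrightarrow> isotonic_regression A w \<theta> x) F"
proof -
  define p where "p = isotonic_regression A w \<theta>"
  define pn where "pn n = isotonic_regression A (wn n) (\<theta>n n)" for n
  \<comment> \<open>Half of the smallest limit weight leaves room for \<open>wn n x\<close> to
    exceed \<open>c\<close> eventually.\<close>
  define c where "c = Min (w ` A) / 2"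
  have c: "c > 0" "\<And>x. x \<in> A \<Longrightarrow> c < w x"
  proof -
    have "Min (w ` A) > 0" "\<And>x. x \<in> A \<Longrightarrow> Min (w ` A) \<le> w x"
      using A w x by (auto intro: Min_gr_iff[THEN iffD2])
    thus "c > 0" "\<And>x. x \<in> A \<Longrightarrow> c < w x" by (force simp: c_def)+
  qed
  define D where "D n = (\<Sum>x\<in>A. (wn n x * (\<theta>n n x - p x) - w x * (\<theta> x - p x))\<^sup>2)" for n
  have "eventually (\<lambda>n. \<forall>x\<in>A. c < wn n x) F"
    using A c by (intro eventually_ball_finite ballI order_tendstoD(1)[OF wn]) auto
  hence bound: "eventually (\<lambda>n. \<bar>pn n x - p x\<bar> \<le> sqrt (D n / c\<^sup>2)) F"
  proof eventually_elim
    case (elim n)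
    hence wn_pos: "\<And>x. x \<in> A \<Longrightarrow> wn n x > 0" using c(1) by force
    have "c\<^sup>2 * (pn n x - p x)\<^sup>2 \<le> c\<^sup>2 * (\<Sum>x\<in>A. (pn n x - p x)\<^sup>2)"
      using A x by (intro mult_left_mono member_le_sum) auto
    also have "\<dots> \<le> D n"
      unfolding D_def
      using mono_on_isotonic_regression[OF A w] isotonic_regression_minimizes[OF A w]
        mono_on_isotonic_regression[OF A wn_pos] isotonic_regression_minimizes[OF A wn_pos] elim c
      by (intro isotonic_minimizer_stable) (auto simp: p_def pn_def intro: less_imp_le)
    finally have "(pn n x - p x)\<^sup>2 \<le> D n / c\<^sup>2"
      using c(1) by (simp add: field_simps)
    thus ?case
      by (intro real_le_rsqrt) simp
  qed
  have "((\<lambda>n. sqrt (D n / c\<^sup>2)) \<longlongrightarrow> sqrt ((\<Sum>x\<in>A. (w x * (\<theta> x - p x) - w x * (\<theta> x - p x))\<^sup>2) / c\<^sup>2)) F"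
    unfolding D_def using c(1) by (intro tendsto_intros wn \<theta>n) auto
  hence "((\<lambda>n. sqrt (D n / c\<^sup>2)) \<longlongrightarrow> 0) F" by simp
  with bound[folded real_norm_def] have "((\<lambda>n. pn n x - p x) \<longlongrightarrow> 0) F"
    by (rule Lim_null_comparison)
  thus ?thesis
    unfolding pn_def p_def by (rule LIM_zero_cancel)
qed

text \<open>Follows from continuity in the data for fixed weights; over a countable index type,
  Borel measurability into the function space can be checked coordinatewise.\<close>

lemma borel_measurable_isotonic_regression:
  fixes A :: "'a::{order, countable} set"
  assumes A: "finite A" and w: "\<And>x. x \<in> A \<Longrightarrow> w x > 0" and x: "x \<in> A"
    and V: "\<And>y. y \<in> A \<Longrightarrow> (\<lambda>\<omega>. V \<omega> y) \<in> borel_measurable M"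
  shows "(\<lambda>\<omega>. isotonic_regression A w (V \<omega>) x) \<in> borel_measurable M"
proof -
  \<comment> \<open>Nothing is known about the coordinates of \<open>V\<close> off \<open>A\<close>;
    replacing them by 0 does not change the regression.\<close>
  define V' where "V' \<omega> y = (if y \<in> A then V \<omega> y else 0)" for \<omega> y
  have "continuous_on UNIV (\<lambda>\<theta>. isotonic_regression A w \<theta> x)"
  proof (subst continuous_on_eq_continuous_at, simp, intro ballI)
    fix \<theta> :: "'a \<Rightarrow> real"
    have "((\<lambda>\<theta>. \<theta> y) \<longlongrightarrow> \<theta> y) (at \<theta>)" for y
      using continuous_on_product_coordinates[where i = y and 'b = real]
      by (simp add: continuous_on_def)
    thus "isCont (\<lambda>\<theta>. isotonic_regression A w \<theta> x) \<theta>"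
      unfolding isCont_def using assms by (intro tendsto_isotonic_regression) auto
  qed
  hence "(\<lambda>\<theta>. isotonic_regression A w \<theta> x) \<in> borel_measurable borel"
    by (rule borel_measurable_continuous_onI)
  moreover have "V' \<in> borel_measurable M"
    proof (rule measurable_coordinatewise_then_product)
    show "(\<lambda>\<omega>. V' \<omega> y) \<in> borel_measurable M" for y
      using V by (cases "y \<in> A") (auto simp: V'_def)
  qed
  ultimately have "(\<lambda>\<omega>. isotonic_regression A w (V' \<omega>) x) \<in> borel_measurable M"
    by (rule measurable_compose[rotated])
  moreover have "isotonic_regression A w (V' \<omega>) = isotonic_regression A w (V \<omega>)" for \<omega>
    by (intro isotonic_regression_cong) (auto simp: V'_def)
  ultimately show ?thesis by simp
qed

section \<open>Comparable level sets and the decoupling of the regression\<close>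

lemma comparable_level_set_subset:
  assumes "x \<in> X"
  shows "comparable_level_set X g x \<subseteq> {z \<in> X. g z = g x}"
proof
  fix y assume "y \<in> comparable_level_set X g x"
  hence "(x, y) \<in> (comparability_graph {z \<in> X. g z = g x})\<^sup>*"
    by (simp add: comparable_level_set_def)
  thus "y \<in> {z \<in> X. g z = g x}"
    by (induction rule: rtrancl_induct) (auto simp: comparability_graph_def assms)
qed

lemma comparable_level_set_refl: "x \<in> comparable_level_set X g x"
  by (simp add: comparable_level_set_def)

lemma comparable_level_set_eq:
  assumes x: "x \<in> X" and y: "y \<in> comparable_level_set X g x"
  shows "comparable_level_set X g y = comparable_level_set X g x"
proof -
  let ?R = "(comparability_graph {z \<in> X. g z = g x})\<^sup>*"
  have "sym ?R"
    by (intro sym_rtrancl) (auto simp: sym_def comparability_graph_def)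
  moreover have "(x, y) \<in> ?R"
    using y by (simp add: comparable_level_set_def)
  moreover have "g y = g x"
    using comparable_level_set_subset[OF x] y by blast
  ultimately show ?thesis
    by (auto simp: comparable_level_set_def dest: symD intro: rtrancl_trans)
qed

lemma comparable_level_set_comparable:
  assumes "x \<in> X" "y \<in> X" "x \<le> y" "g x = g y"
  shows "y \<in> comparable_level_set X g x"
  using assms by (auto simp: comparable_level_set_def comparability_graph_def intro!: r_into_rtrancl)

lemma sum_comparable_level_sets:
  assumes "finite X"
  shows "(\<Sum>x\<in>X. f x) = (\<Sum>C \<in> comparable_level_set X g ` X. \<Sum>x\<in>C. f x)"
proof -
  let ?C = "comparable_level_set X g ` X"
  have sub: "C \<subseteq> X" if "C \<in> ?C" for C
    using that comparable_level_set_subset by blast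
  have "\<Union>?C = X"
    using sub comparable_level_set_refl by blast
  moreover have "C \<inter> D = {}" if CD: "C \<in> ?C" "D \<in> ?C" "C \<noteq> D" for C D
  proof (rule ccontr)
    assume "C \<inter> D \<noteq> {}"
    then obtain z where "z \<in> C" "z \<in> D" by blast
    moreover obtain x y where "x \<in> X" "y \<in> X" "C = comparable_level_set X g x" "D = comparable_level_set X g y"
      using CD by blast
    ultimately have "C = D"
      using comparable_level_set_eq by metis
    thus False using CD by simp
  qed
  ultimately show ?thesis
    using sum.Union_disjoint[of ?C f] sub assms by (auto intro: finite_subset)
qed

text \<open>Dropping the constraints between different classes relaxes the problem, and the relaxed
  problem splits into one regression per class. Once the concatenated solution meets the dropped
  constraints as well, it solves the original problem.\<close>

lemma isotonic_regression_glue: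
  fixes X :: "'a::order set"
  assumes X: "finite X" and w: "\<And>x. x \<in> X \<Longrightarrow> w x > 0" and s: "s > 0"
    and mono: "mono_on X (\<lambda>x. g x + isotonic_on_level_sets X g w v x / s)"
    and x: "x \<in> X"
  shows "isotonic_regression X w (\<lambda>x. g x + v x / s) x = g x + isotonic_on_level_sets X g w v x / s"
  using X w mono
proof (rule isotonic_regression_eqI)
  fix f :: "'a \<Rightarrow> real" assume f: "mono_on X f"
  let ?h = "isotonic_on_level_sets X g w v"
  let ?\<theta> = "\<lambda>x. g x + v x / s"
  have "(\<Sum>x\<in>C. (g x + ?h x / s - ?\<theta> x)\<^sup>2 * w x) \<le> (\<Sum>x\<in>C. (f x - ?\<theta> x)\<^sup>2 * w x)"
    if C: "C \<in> comparable_level_set X g ` X" for C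
  proof -
    obtain z where z: "z \<in> X" "C = comparable_level_set X g z" using C by blast
    have CX: "C \<subseteq> X" and gC: "\<And>y. y \<in> C \<Longrightarrow> g y = g z"
      using comparable_level_set_subset[OF z(1), of g] z(2) by blast+
    have hC: "?h y = isotonic_regression C w v y" if "y \<in> C" for y
      using that CX comparable_level_set_eq[OF z(1), of y g] z(2)
      by (auto simp: isotonic_on_level_sets_def)
    have C: "finite C" "\<And>y. y \<in> C \<Longrightarrow> w y > 0"
      using CX w X finite_subset by auto
    \<comment> \<open>As \<open>g\<close> is constant on \<open>C\<close>, passing from
      \<open>f\<close> to \<open>s * (f - g)\<close> preserves isotonicity there; it multiplies the
      objective by \<open>s\<^sup>2\<close> and moves the comparison to the scale of
      \<open>v\<close>.\<close>
    have "mono_on C (\<lambda>y. s * (f y - g y))"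
      using f CX s gC by (auto simp: mono_on_def subset_iff intro!: mult_left_mono)
    hence "(\<Sum>y\<in>C. (isotonic_regression C w v y - v y)\<^sup>2 * w y) \<le> (\<Sum>y\<in>C. (s * (f y - g y) - v y)\<^sup>2 * w y)"
      using C by (intro isotonic_regression_minimizes)
    also have "\<dots> = s\<^sup>2 * (\<Sum>x\<in>C. (f x - ?\<theta> x)\<^sup>2 * w x)"
      unfolding sum_distrib_left using s by (intro sum.cong) (auto simp: field_simps power2_eq_square)
    also have "(\<Sum>y\<in>C. (isotonic_regression C w v y - v y)\<^sup>2 * w y)
        = s\<^sup>2 * (\<Sum>x\<in>C. (g x + ?h x / s - ?\<theta> x)\<^sup>2 * w x)"
      unfolding sum_distrib_left using s
      by (intro sum.cong) (auto simp: hC field_simps power2_eq_square)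
    finally show ?thesis using s by simp
  qed
  thus "(\<Sum>x\<in>X. (g x + ?h x / s - ?\<theta> x)\<^sup>2 * w x) \<le> (\<Sum>x\<in>X. (f x - ?\<theta> x)\<^sup>2 * w x)"
    unfolding sum_comparable_level_sets[OF X, where g = g] by (rule sum_mono)
qed (use x in auto)

lemma tendsto_isotonic_on_level_sets:
  fixes X :: "'a::order set"
  assumes X: "finite X" and w: "\<And>x. x \<in> X \<Longrightarrow> w x > 0"
    and wn: "\<And>x. x \<in> X \<Longrightarrow> ((\<lambda>n. wn n x) \<longlongrightarrow> w x) F"
    and vn: "\<And>x. x \<in> X \<Longrightarrow> ((\<lambda>n. vn n x) \<longlongrightarrow> v x) F"
    and x: "x \<in> X"
  shows "((\<lambda>n. isotonic_on_level_sets X g (wn n) (vn n) x) \<longlongrightarrow> isotonic_on_level_sets X g w v x) F"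
proof -
  have "comparable_level_set X g x \<subseteq> X"
    using comparable_level_set_subset[OF x] by blast
  hence "((\<lambda>n. isotonic_regression (comparable_level_set X g x) (wn n) (vn n) x) \<longlongrightarrow>
      isotonic_regression (comparable_level_set X g x) w v x) F"
    using assms by (intro tendsto_isotonic_regression) (auto intro: finite_subset comparable_level_set_refl)
  thus ?thesis using x by (simp add: isotonic_on_level_sets_def)
qed

text \<open>Near \<open>g\<close>, the order constraints between different level sets of \<open>g\<close> are slack, so
  for large \<open>s\<close> the regression decouples into the comparable level sets.\<close>

lemma tendsto_scaled_isotonic_regression:
  fixes X :: "'a::order set"
  assumes X: "finite X" and g: "mono_on X g" and w: "\<And>x. x \<in> X \<Longrightarrow> w x > 0"
    and wn: "\<And>x. x \<in> X \<Longrightarrow> ((\<lambda>n. wn n x) \<longlongrightarrow> w x) F"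
    and vn: "\<And>x. x \<in> X \<Longrightarrow> ((\<lambda>n. vn n x) \<longlongrightarrow> v x) F"
    and s: "filterlim s at_top F"
    and x: "x \<in> X"
  shows "((\<lambda>n. s n * (isotonic_regression X (wn n) (\<lambda>x. g x + vn n x / s n) x - g x))
    \<longlongrightarrow> isotonic_on_level_sets X g w v x) F"
proof -
  define h where "h n = isotonic_on_level_sets X g (wn n) (vn n)" for n
  have h: "((\<lambda>n. h n y) \<longlongrightarrow> isotonic_on_level_sets X g w v y) F" if "y \<in> X" for y
    unfolding h_def using assms that by (intro tendsto_isotonic_on_level_sets) auto
  have s_pos: "eventually (\<lambda>n. s n > 0) F"
    using s by (simp add: filterlim_at_top_dense)
  have w_pos: "eventually (\<lambda>n. \<forall>y\<in>X. wn n y > 0) F"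
    using X w by (intro eventually_ball_finite ballI order_tendstoD(1)[OF wn]) auto
  have le: "eventually (\<lambda>n. y \<le> z \<longrightarrow> g y + h n y / s n \<le> g z + h n z / s n) F"
    if yz: "y \<in> X" "z \<in> X" for y z
  proof (cases "g y < g z")
    case True
    have "((\<lambda>n. g y + h n y / s n) \<longlongrightarrow> g y + 0) F" "((\<lambda>n. g z + h n z / s n) \<longlongrightarrow> g z + 0) F"
      using yz by (intro tendsto_add tendsto_const real_tendsto_divide_at_top[OF h s]; simp)+
    hence "((\<lambda>n. (g z + h n z / s n) - (g y + h n y / s n)) \<longlongrightarrow> g z - g y) F"
      by (auto dest: tendsto_diff)
    hence "eventually (\<lambda>n. (g z + h n z / s n) - (g y + h n y / s n) > 0) F"
      using True by (intro order_tendstoD) auto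
    thus ?thesis by eventually_elim auto
  next
    \<comment> \<open>A pair \<open>y \<le> z\<close> now has \<open>g y = g z\<close> by
      isotonicity of \<open>g\<close>, so it lies in one class, on which the regression is itself
      isotonic.\<close>
    case False
    show ?thesis
      using s_pos w_pos
    proof eventually_elim
      case (elim n)
      show ?case
      proof
        assume "y \<le> z"
        with False g yz have eq: "g y = g z"
          by (meson mono_onD not_less antisym)
        let ?C = "comparable_level_set X g y"
        have z: "z \<in> ?C" using yz \<open>y \<le> z\<close> eq by (intro comparable_level_set_comparable)
        have "?C \<subseteq> X" using comparable_level_set_subset[OF yz(1)] by blast
        hence "mono_on ?C (isotonic_regression ?C (wn n) (vn n))"
          using elim X by (intro mono_on_isotonic_regression) (auto intro: finite_subset)
        from mono_onD[OF this comparable_level_set_refl z \<open>y \<le> z\<close>]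
        have "h n y \<le> h n z"
          using yz comparable_level_set_eq[OF yz(1) z] by (simp add: h_def isotonic_on_level_sets_def)
        thus "g y + h n y / s n \<le> g z + h n z / s n"
          using eq elim(1) by (simp add: divide_right_mono)
      qed
    qed
  qed
  have "eventually (\<lambda>n. \<forall>y\<in>X. \<forall>z\<in>X. y \<le> z \<longrightarrow> g y + h n y / s n \<le> g z + h n z / s n) F"
    using X le by (intro eventually_ball_finite ballI)
  with s_pos w_pos have "eventually (\<lambda>n. h n x =
      s n * (isotonic_regression X (wn n) (\<lambda>x. g x + vn n x / s n) x - g x)) F"
  proof eventually_elim
    case (elim n)
    hence "isotonic_regression X (wn n) (\<lambda>x. g x + vn n x / s n) x = g x + h n x / s n"
      unfolding h_def using X x by (intro isotonic_regression_glue) (auto simp: mono_on_def)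
    thus ?case using elim(1) by simp
  qed
  thus ?thesis using h[OF x] by (rule Lim_transform_eventually[rotated])
qed

section \<open>Characteristic functions of random vectors\<close>

text \<open>The characteristic function at 0 is the total mass, so both measures are normalised by
  the same constant and uniqueness for probability laws applies; mass 0 is treated apart.\<close>

lemma finite_measure_eqI_char:
  fixes \<mu> \<nu> :: "real measure"
  assumes \<mu>: "finite_measure \<mu>" "sets \<mu> = sets borel" and \<nu>: "finite_measure \<nu>" "sets \<nu> = sets borel"
    and char: "\<And>t. char \<mu> t = char \<nu> t"
  shows "\<mu> = \<nu>"
proof -
  have space: "space \<mu> = UNIV" "space \<nu> = UNIV"
    using sets_eq_imp_space_eq[OF \<mu>(2)] sets_eq_imp_space_eq[OF \<nu>(2)] by simp_all
  define c where "c = measure \<mu> UNIV"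
  have c': "measure \<nu> UNIV = c"
    using char[of 0] by (simp add: char_def c_def space)
  have em: "emeasure \<mu> UNIV = ennreal c" "emeasure \<nu> UNIV = ennreal c"
    using \<mu>(1) \<nu>(1) c' by (simp_all add: c_def finite_measure.emeasure_eq_measure)
  show ?thesis
  proof (cases "c = 0")
    case True
    have "emeasure \<mu> A = 0" "emeasure \<nu> A = 0" for A
      using em True emeasure_space[of \<mu> A] emeasure_space[of \<nu> A] by (auto simp: space)
    thus ?thesis using \<mu>(2) \<nu>(2) by (intro measure_eqI) auto
  next
    case False
    hence c: "c > 0" by (simp add: c_def zero_less_measure_iff)
    define norm where "norm m = density m (\<lambda>_. ennreal (1 / c))" for m :: "real measure"
    have real_distr: "real_distribution (norm m)"
      if "sets m = sets borel" "emeasure m UNIV = ennreal c" for m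
    proof -
      have "space m = UNIV" using sets_eq_imp_space_eq[OF that(1)] by simp
      hence "prob_space (norm m)"
        using that c by (intro prob_spaceI)
          (simp add: norm_def emeasure_density_const ennreal_mult'[symmetric])
      thus ?thesis
        using that by (simp add: real_distribution_def real_distribution_axioms_def norm_def)
    qed
    have char_norm: "char (norm m) t = (1 / c) *\<^sub>R char m t" if "sets m = sets borel" for m t
      unfolding norm_def char_def using c that
      by (subst integral_density) (auto simp: measurable_cong_sets[OF that refl])
    have "norm \<mu> = norm \<nu>"
      using \<mu>(2) \<nu>(2) em char by (intro Levy_uniqueness real_distr ext) (auto simp: char_norm)
    moreover have "m = density (norm m) (\<lambda>_. ennreal c)" for m :: "real measure"
      unfolding norm_def using c
      by (subst density_density_eq) (auto simp: ennreal_mult'[symmetric] density_1)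
    ultimately show ?thesis by metis
  qed
qed

text \<open>The weights \<open>1 + cos (L + \<theta>)\<close> are nonnegative, so they turn the law of \<open>X\<close> into a finite
  measure to which uniqueness of real characteristic functions applies; the phase \<open>iexp L\<close> is a
  combination of such weights.\<close>

lemma integral_indicator_iexp_eqI:
  fixes P Q :: "'a measure" and W L X :: "'a \<Rightarrow> real"
  assumes P: "prob_space P" and Q: "prob_space Q" and sets: "sets P = sets Q"
    and W: "W \<in> borel_measurable P" "\<And>x. 0 \<le> W x" "\<And>x. W x \<le> 1"
    and L: "L \<in> borel_measurable P" and X: "X \<in> borel_measurable P"
    and eq: "\<And>s t. (\<integral>x. W x * iexp (s * L x + t * X x) \<partial>P) = (\<integral>x. W x * iexp (s * L x + t * X x) \<partial>Q)"
    and B: "B \<in> sets borel"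
  shows "(\<integral>x. W x * indicator B (X x) * iexp (L x) \<partial>P) = (\<integral>x. W x * indicator B (X x) * iexp (L x) \<partial>Q)"
proof -
  define u where "u \<theta> x = W x * (1 + cos (L x + \<theta>))" for \<theta> x
  have u_nonneg: "0 \<le> u \<theta> x" for \<theta> x
    unfolding u_def using cos_ge_minus_one[of "L x + \<theta>"] by (intro mult_nonneg_nonneg[OF W(2)]) linarith
  have u_le: "u \<theta> x \<le> 2" for \<theta> x
    unfolding u_def using mult_mono[OF W(3), of "1 + cos (L x + \<theta>)" 2 x] cos_ge_minus_one[of "L x + \<theta>"] by simp
  define \<nu> where "\<nu> R \<theta> = distr (density R (\<lambda>x. ennreal (u \<theta> x))) borel X" for R :: "'a measure" and \<theta>
  \<comment> \<open>\<open>p R\<close> is the characteristic function of the pair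
    \<open>(L, X)\<close> under the weight \<open>W\<close>, with frequency \<open>t\<close> for
    \<open>X\<close> and \<open>s\<close> for \<open>L\<close>.\<close>
  define p where "p R t s = (\<integral>x. W x * iexp (s * L x + t * X x) \<partial>R)" for R :: "'a measure" and t s
  have R: "finite_measure (\<nu> R \<theta>)"
    "char (\<nu> R \<theta>) t = p R t 0 + iexp \<theta> / 2 * p R t 1 + iexp (- \<theta>) / 2 * p R t (- 1)"
    "measure (\<nu> R \<theta>) B = (\<integral>x. u \<theta> x * indicator B (X x) \<partial>R)"
    "integrable R (\<lambda>x. u \<theta> x * indicator B (X x))"
    if R: "prob_space R" "sets R = sets P" for R \<theta> t
  proof -
    interpret prob_space R by (rule R)
    have [measurable]: "W \<in> borel_measurable R" "L \<in> borel_measurable R" "X \<in> borel_measurable R"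
      using W L X R(2) by (simp_all cong: measurable_cong_sets)
    have [measurable]: "u \<theta> \<in> borel_measurable R" unfolding u_def by measurable
    have [measurable]: "B \<in> sets borel" by (rule B)
    have "integrable R (u \<theta>)"
      using u_nonneg u_le by (intro integrable_const_bound[of _ 2]) auto
    hence "emeasure (density R (\<lambda>x. ennreal (u \<theta> x))) (space R) < \<infinity>"
      using u_nonneg by (subst emeasure_density) (auto simp: nn_integral_eq_integral cong: nn_integral_cong)
    hence "finite_measure (density R (\<lambda>x. ennreal (u \<theta> x)))"
      by (intro finite_measureI) (auto simp: less_top)
    thus fin: "finite_measure (\<nu> R \<theta>)"
      unfolding \<nu>_def by (intro finite_measure.finite_measure_distr) auto
    have int: "integrable R (\<lambda>x. W x * iexp (s * L x + t * X x))" for s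
      using W by (intro integrable_const_bound[of _ 1]) (auto simp: norm_mult)
    have "char (\<nu> R \<theta>) t = (\<integral>x. u \<theta> x *\<^sub>R iexp (t * X x) \<partial>R)"
      unfolding char_def \<nu>_def using u_nonneg
      by (subst integral_distr, simp, simp, subst integral_density) auto
    also have "\<dots> = (\<integral>x. W x * iexp (0 * L x + t * X x) + iexp \<theta> / 2 * (W x * iexp (1 * L x + t * X x))
        + iexp (- \<theta>) / 2 * (W x * iexp (- 1 * L x + t * X x)) \<partial>R)"
    proof (intro Bochner_Integration.integral_cong refl)
      fix x
      \<comment> \<open>Writing the cosine as a sum of two exponentials produces the frequencies 0,
        1 and -1 for \<open>L\<close>.\<close>
      have "u \<theta> x *\<^sub>R iexp (t * X x)
          = W x * (iexp (t * X x) + (iexp (L x + \<theta>) + iexp (- (L x + \<theta>))) / 2 * iexp (t * X x))"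
        unfolding u_def scaleR_conv_of_real
        by (simp add: cos_of_real[symmetric] cos_exp_eq algebra_simps)
      also have "\<dots> = W x * iexp (0 * L x + t * X x) + iexp \<theta> / 2 * (W x * iexp (1 * L x + t * X x))
        + iexp (- \<theta>) / 2 * (W x * iexp (- 1 * L x + t * X x))"
        by (simp add: algebra_simps exp_add exp_diff exp_minus field_simps)
      finally show "u \<theta> x *\<^sub>R iexp (t * X x) = \<dots>" .
    qed
    also have "\<dots> = p R t 0 + iexp \<theta> / 2 * p R t 1 + iexp (- \<theta>) / 2 * p R t (- 1)"
      unfolding p_def
      by (subst Bochner_Integration.integral_add Bochner_Integration.integral_mult_right_zero
            | intro Bochner_Integration.integrable_add integrable_mult_right int refl)+
    finally show "char (\<nu> R \<theta>) t = \<dots>" .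
    show "integrable R (\<lambda>x. u \<theta> x * indicator B (X x))"
      using u_nonneg u_le by (intro integrable_const_bound[of _ 2]) (auto simp: indicator_def)
    have "measure (\<nu> R \<theta>) B = (\<integral>y. indicator B y \<partial>\<nu> R \<theta>)"
      by (simp add: \<nu>_def)
    also have "\<dots> = (\<integral>x. u \<theta> x * indicator B (X x) \<partial>R)"
      unfolding \<nu>_def using u_nonneg
      by (subst integral_distr, simp, simp, subst integral_density) auto
    finally show "measure (\<nu> R \<theta>) B = \<dots>" .
  qed
  have p_eq: "p P t s = p Q t s" for t s
    unfolding p_def by (rule eq)
  have "\<nu> P \<theta> = \<nu> Q \<theta>" for \<theta>
  proof (rule finite_measure_eqI_char)
    show "char (\<nu> P \<theta>) t = char (\<nu> Q \<theta>) t" for t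
      unfolding R(2)[OF P refl] R(2)[OF Q sets[symmetric]] p_eq ..
  qed (use R(1) P Q sets in \<open>auto simp: \<nu>_def\<close>)
  hence u_eq: "(\<integral>x. u \<theta> x * indicator B (X x) \<partial>P) = (\<integral>x. u \<theta> x * indicator B (X x) \<partial>Q)" for \<theta>
    using R(3)[OF P refl] R(3)[OF Q sets[symmetric]] by metis
  \<comment> \<open>Four phases recover the complex factor: subtracting opposite phases cancels the
    constant 1 in \<open>1 + cos (L x + \<theta>)\<close>. The phases 0 and \<open>pi\<close> leave
    \<open>cos (L x)\<close>, the phases \<open>- pi / 2\<close> and \<open>pi / 2\<close> leave
    \<open>sin (L x)\<close>.\<close>
  define I where "I R \<theta> = complex_of_real (\<integral>x. u \<theta> x * indicator B (X x) \<partial>R)" for R :: "'a measure" and \<theta>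
  have "(\<integral>x. W x * indicator B (X x) * iexp (L x) \<partial>R)
      = (I R 0 - I R pi) / 2 + \<i> * ((I R (- pi / 2) - I R (pi / 2)) / 2)"
    if "prob_space R" "sets R = sets P" for R
  proof -
    define v where "v \<theta> x = complex_of_real (u \<theta> x * indicator B (X x))" for \<theta> x
    have v: "integrable R (v \<theta>)" for \<theta>
      unfolding v_def by (intro integrable_of_real R(4)[OF that])
    have I: "I R \<theta> = (\<integral>x. v \<theta> x \<partial>R)" for \<theta>
      unfolding I_def v_def by (rule integral_complex_of_real[symmetric])
    have "(\<integral>x. W x * indicator B (X x) * iexp (L x) \<partial>R)
        = (\<integral>x. (v 0 x - v pi x) / 2 + \<i> * ((v (- pi / 2) x - v (pi / 2) x) / 2) \<partial>R)"
    proof (intro Bochner_Integration.integral_cong refl)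
      fix x
      have "u 0 x - u pi x = 2 * (W x * cos (L x))"
        "u (- pi / 2) x - u (pi / 2) x = 2 * (W x * sin (L x))"
        by (simp_all add: u_def cos_add cos_diff algebra_simps)
      hence "v 0 x - v pi x = 2 * (W x * cos (L x) * indicator B (X x))"
        "v (- pi / 2) x - v (pi / 2) x = 2 * (W x * sin (L x) * indicator B (X x))"
        by (auto simp: v_def indicator_def of_real_diff[symmetric] simp del: of_real_diff)
      thus "W x * indicator B (X x) * iexp (L x)
          = (v 0 x - v pi x) / 2 + \<i> * ((v (- pi / 2) x - v (pi / 2) x) / 2)"
        by (simp add: exp_Euler cos_of_real sin_of_real indicator_def algebra_simps)
    qed
    also have "\<dots> = (I R 0 - I R pi) / 2 + \<i> * ((I R (- pi / 2) - I R (pi / 2)) / 2)"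
      using v I by simp
    finally show ?thesis .
  qed
  from this[OF P refl] this[OF Q sets[symmetric]] show ?thesis
    by (simp add: I_def u_eq)
qed

text \<open>Exponentials are traded for indicators one coordinate at a time. With none traded the
  claim is the hypothesis; with all traded and zero frequencies it is equality on boxes, which
  generate the product sigma-algebra.\<close>

theorem measure_PiM_eqI_char:
  fixes P Q :: "('i \<Rightarrow> real) measure"
  assumes I: "finite I" and P: "prob_space P" and Q: "prob_space Q"
    and sets: "sets P = sets (Pi\<^sub>M I (\<lambda>_. borel))" "sets Q = sets (Pi\<^sub>M I (\<lambda>_. borel))"
    and eq: "\<And>a. (\<integral>x. iexp (\<Sum>i\<in>I. a i * x i) \<partial>P) = (\<integral>x. iexp (\<Sum>i\<in>I. a i * x i) \<partial>Q)"
  shows "P = Q"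
proof -
  have meas: "(\<lambda>x. x i) \<in> borel_measurable P" if "i \<in> I" for i
    using that by (subst measurable_cong_sets[OF sets(1) refl]) simp
  \<comment> \<open>A coordinate in \<open>J\<close> already carries an indicator, so its frequency
    is required to vanish; the other frequencies stay free because the induction step changes one of
    them.\<close>
  have *: "(\<integral>x. (\<Prod>j\<in>J. indicator (A j) (x j) :: real) * iexp (\<Sum>i\<in>I. a i * x i) \<partial>P)
      = (\<integral>x. (\<Prod>j\<in>J. indicator (A j) (x j) :: real) * iexp (\<Sum>i\<in>I. a i * x i) \<partial>Q)"
    if "finite J" "J \<subseteq> I" "\<And>j. j \<in> J \<Longrightarrow> A j \<in> sets borel" "\<And>j. j \<in> J \<Longrightarrow> a j = 0"
    for J A a
    using that
  proof (induction J arbitrary: a rule: finite_induct)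
    case empty
    thus ?case using eq by simp
  next
    case (insert k J)
    let ?W = "\<lambda>x. \<Prod>j\<in>J. indicator (A j) (x j) :: real"
    let ?L = "\<lambda>x. \<Sum>i\<in>I. a i * x i"
    have "(\<integral>x. ?W x * indicator (A k) (x k) * iexp (?L x) \<partial>P)
        = (\<integral>x. ?W x * indicator (A k) (x k) * iexp (?L x) \<partial>Q)"
    proof (rule integral_indicator_iexp_eqI[OF P Q])
      show "?W \<in> borel_measurable P"
        using insert.prems by (intro borel_measurable_prod measurable_compose[OF meas borel_measurable_indicator]) auto
      show "?L \<in> borel_measurable P"
        by (intro borel_measurable_sum borel_measurable_times meas) auto
      show "?W x \<le> 1" for x
        by (intro prod_le_1) (auto simp: indicator_def)
      show "(\<integral>x. ?W x * iexp (s * ?L x + t * x k) \<partial>P) = (\<integral>x. ?W x * iexp (s * ?L x + t * x k) \<partial>Q)" for s t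
      proof -
        \<comment> \<open>The added term \<open>t * x k\<close> only alters the frequency of
          \<open>k\<close>, which lies outside \<open>J\<close>, so the induction hypothesis applies
          to the new frequencies.\<close>
        have L: "s * ?L x + t * x k = (\<Sum>i\<in>I. (s * a i + (if i = k then t else 0)) * x i)" for x
        proof -
          have "(\<Sum>i\<in>I. (s * a i + (if i = k then t else 0)) * x i)
              = s * ?L x + (\<Sum>i\<in>I. if i = k then t * x k else 0)"
            unfolding sum_distrib_left sum.distrib[symmetric]
            by (intro sum.cong) (auto simp: algebra_simps)
          also have "\<dots> = s * ?L x + t * x k"
            using I insert.prems(1) by (simp add: sum.delta)
          finally show ?thesis by simp
        qed
        have "s * a j + (if j = k then t else 0) = 0" if "j \<in> J" for j
          using that insert.prems insert.hyps(2) by auto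
        thus ?thesis
          unfolding L using insert.prems by (intro insert.IH) auto
      qed
    qed (use sets insert.prems meas in \<open>auto intro!: prod_nonneg\<close>)
    thus ?case
      using insert.hyps by (simp add: mult_ac)
  qed
  show ?thesis
  proof (rule measure_eqI_PiM_finite[OF I sets])
    fix A :: "'i \<Rightarrow> real set" assume A: "\<And>i. i \<in> I \<Longrightarrow> A i \<in> sets borel"
    have meas_eq: "complex_of_real (measure R (Pi\<^sub>E I A)) = (\<integral>x. (\<Prod>j\<in>I. indicator (A j) (x j) :: real) * iexp (\<Sum>i\<in>I. 0 * x i) \<partial>R)"
      if "prob_space R" "sets R = sets (Pi\<^sub>M I (\<lambda>_. borel))" for R :: "('i \<Rightarrow> real) measure"
    proof -
      interpret prob_space R by (rule that)
      have sp: "space R = extensional I"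
        using sets_eq_imp_space_eq[OF that(2)] by (simp add: space_PiM PiE_def)
      have box: "Pi\<^sub>E I A \<in> sets R"
        using A I that(2) by (simp add: sets_PiM_I_finite)
      have "(\<integral>x. (\<Prod>j\<in>I. indicator (A j) (x j) :: real) * iexp (\<Sum>i\<in>I. 0 * x i) \<partial>R)
          = (\<integral>x. complex_of_real (indicator (Pi\<^sub>E I A) x) \<partial>R)"
        using I by (intro Bochner_Integration.integral_cong refl)
          (auto simp: sp indicator_def PiE_iff prod_zero_iff)
      also have "\<dots> = complex_of_real (measure R (Pi\<^sub>E I A))"
        using box by simp
      finally show ?thesis by simp
    qed
    have "complex_of_real (measure P (Pi\<^sub>E I A)) = complex_of_real (measure Q (Pi\<^sub>E I A))"
      using *[of I A "\<lambda>_. 0"] I A meas_eq[OF P sets(1)] meas_eq[OF Q sets(2)] by simp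
    thus "emeasure P (Pi\<^sub>E I A) = emeasure Q (Pi\<^sub>E I A)"
      using P Q by (simp add: finite_measure.emeasure_eq_measure prob_space_def)
  next
    show "range (\<lambda>_::nat. space (Pi\<^sub>M I (\<lambda>_. borel :: real measure))) \<subseteq> prod_algebra I (\<lambda>_. borel)"
      using I by (auto simp: space_PiM intro!: prod_algebraI_finite)
    show "emeasure P (space (Pi\<^sub>M I (\<lambda>_. borel :: real measure))) \<noteq> \<infinity>"
      using P by (simp add: finite_measure.emeasure_eq_measure prob_space_def)
  qed simp
qed

section \<open>Coupled central limit theorem\<close>

lemma char_distr_cmult:
  assumes "Z \<in> borel_measurable M"
  shows "char (distr M borel (\<lambda>\<omega>. c * Z \<omega>)) t = char (distr M borel Z) (c * t)"
  using assms by (simp add: char_def integral_distr mult_ac)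

lemma char_normal_law:
  assumes "v \<ge> 0"
  shows "char (normal_law 0 v) t = complex_of_real (exp (- (v * t\<^sup>2) / 2))"
proof (cases "v = 0")
  case True
  thus ?thesis by (simp add: normal_law_def char_def integral_return)
next
  case False
  define s where "s = sqrt v"
  have s: "s > 0" "s\<^sup>2 = v" using False assms by (simp_all add: s_def)
  define D where "D = density lborel (normal_density 0 s)"
  interpret D: prob_space D
    unfolding D_def using s by (intro prob_space_normal_density)
  have "distributed D lborel (\<lambda>x. x) (normal_density 0 s)"
    by (auto simp: distributed_def D_def distr_id2)
  hence "distributed D lborel (\<lambda>x. (x - 0) / s) std_normal_density"
    using s by (subst (asm) D.normal_standard_normal_convert) auto
  hence std: "distr D lborel (\<lambda>x. x / s) = std_normal_distribution"
    by (simp add: distributed_def)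
  have "char D t = (\<integral>x. iexp ((s * t) * (x / s)) \<partial>D)"
    using s by (simp add: char_def)
  also have "\<dots> = char (distr D lborel (\<lambda>x. x / s)) (s * t)"
    unfolding char_def by (subst integral_distr) (auto simp: D_def)
  also have "\<dots> = complex_of_real (exp (- (v * t\<^sup>2) / 2))"
    unfolding std char_std_normal_distribution using s(2) by (simp add: power_mult_distrib)
  finally show ?thesis
    using False by (simp add: normal_law_def D_def s_def)
qed

text \<open>Serves to renumber the errors, which start at 1, as a sequence starting at 0, the form
  that the central limit theorem takes.\<close>

lemma (in prob_space) indep_vars_reindex:
  assumes inj: "inj_on h I" and indep: "indep_vars N X (h ` I)"
  shows "indep_vars (N \<circ> h) (X \<circ> h) I"
  unfolding indep_vars_def2 indep_sets_def
proof (intro conjI ballI allI impI)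
  fix i assume "i \<in> I"
  thus "random_variable ((N \<circ> h) i) ((X \<circ> h) i)"
    using indep by (simp add: indep_vars_def2)
  thus "{(X \<circ> h) i -` A \<inter> space M |A. A \<in> sets ((N \<circ> h) i)} \<subseteq> events"
    by (auto dest: measurable_sets)
next
  fix J A assume J: "J \<subseteq> I" "J \<noteq> {}" "finite J"
    and A: "A \<in> (\<Pi> i\<in>J. {(X \<circ> h) i -` A \<inter> space M |A. A \<in> sets ((N \<circ> h) i)})"
  define B where "B = A \<circ> the_inv_into I h"
  have B: "B (h j) = A j" if "j \<in> J" for j
    using that J inj by (auto simp: B_def the_inv_into_f_f)
  have inj_J: "inj_on h J"
    using inj J(1) by (rule inj_on_subset)
  have "B \<in> (\<Pi> i\<in>h ` J. {X i -` A \<inter> space M |A. A \<in> sets (N i)})"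
    using A B by (auto simp: Pi_iff)
  hence "prob (\<Inter>j\<in>h ` J. B j) = (\<Prod>j\<in>h ` J. prob (B j))"
    using indep J unfolding indep_vars_def2 indep_sets_def by (meson finite_imageI image_is_empty image_mono)
  thus "prob (\<Inter>j\<in>J. A j) = (\<Prod>j\<in>J. prob (A j))"
    using B inj_J by (simp add: prod.reindex)
qed

text \<open>\<open>U m\<close> copies the sum of \<open>m\<close> variables divided by
  \<open>sqrt (real m)\<close>, and \<open>U'\<close> the normal limit. Laws are recorded as
  characteristic functions because these multiply over independent cells; for \<open>m = 0\<close>
  both sides are 1.\<close>

lemma (in prob_space) clt_coupling:
  fixes X :: "nat \<Rightarrow> 'a \<Rightarrow> real"
  assumes indep: "indep_vars (\<lambda>_. borel) X UNIV"
    and mean: "\<And>i. expectation (X i) = 0"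
    and sq_int: "\<And>i. integrable M (\<lambda>\<omega>. (X i \<omega>)\<^sup>2)"
    and var: "\<And>i. variance (X i) = \<sigma>\<^sup>2"
    and distr: "\<And>i. distr M borel (X i) = \<mu>"
  obtains \<Omega> :: "real measure" and U :: "nat \<Rightarrow> real \<Rightarrow> real" and U' :: "real \<Rightarrow> real"
  where "prob_space \<Omega>" "\<And>m. U m \<in> borel_measurable \<Omega>" "U' \<in> borel_measurable \<Omega>"
    and "\<And>\<omega>. \<omega> \<in> space \<Omega> \<Longrightarrow> (\<lambda>m. U m \<omega>) \<longlonglongrightarrow> U' \<omega>"
    and "\<And>m t. char (distr \<Omega> borel (U m)) t = char \<mu> (t / sqrt (real m)) ^ m"
    and "\<And>t. char (distr \<Omega> borel U') t = complex_of_real (exp (- (\<sigma> * t)\<^sup>2 / 2))"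
proof (cases "\<sigma> = 0")
  \<comment> \<open>Standardising would divide by 0. Instead the variables vanish almost surely, so
    zero functions on a point mass serve as copies.\<close>
  case True
  have meas: "X 0 \<in> borel_measurable M"
    using indep by (auto simp: indep_vars_def2)
  have "AE \<omega> in M. (X 0 \<omega>)\<^sup>2 = 0"
    using var[of 0, unfolded mean] sq_int[of 0] True integral_nonneg_eq_0_iff_AE[OF sq_int[of 0]] by simp
  hence zero: "AE \<omega> in M. X 0 \<omega> = 0" by simp
  have "char \<mu> t = 1" for t
  proof -
    have "char \<mu> t = (\<integral>\<omega>. iexp (t * X 0 \<omega>) \<partial>M)"
      using meas by (simp add: distr[of 0, symmetric] char_def integral_distr)
    also have "\<dots> = (\<integral>\<omega>. 1 \<partial>M)"
      using zero meas by (intro integral_cong_AE) auto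
    finally show ?thesis by (simp add: prob_space)
  qed
  moreover have "char (distr (return borel 0) borel (\<lambda>_. 0)) t = 1" for t
    by (simp add: char_def integral_distr integral_return measure_return)
  ultimately show thesis
    using True by (intro that[of "return borel 0" "\<lambda>_ _. 0" "\<lambda>_. 0"]) (auto intro: prob_space_return)
next
  case False
  \<comment> \<open>\<open>\<sigma>\<close> may be negative, whereas the central limit theorem asks
    for a positive standard deviation.\<close>
  define s where "s = \<bar>\<sigma>\<bar>"
  have s: "s > 0" "s\<^sup>2 = \<sigma>\<^sup>2" using False by (auto simp: s_def)
  have meas [measurable]: "X i \<in> borel_measurable M" for i
    using indep by (auto simp: indep_vars_def2)
  define T where "T n \<omega> = (\<Sum>i<n. X i \<omega>) / sqrt (real n * s\<^sup>2)" for n \<omega>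
  have T [measurable]: "T n \<in> borel_measurable M" for n
    unfolding T_def by measurable
  have clt: "weak_conv_m (\<lambda>n. distr M borel (T n)) std_normal_distribution"
    unfolding T_def using indep mean s(1) sq_int var[folded s(2)] distr
    by (rule central_limit_theorem_zero_mean)
  obtain \<Omega> :: "real measure" and Y Y' where \<Omega>: "prob_space \<Omega>" "\<And>n. Y n \<in> borel_measurable \<Omega>"
    "\<And>n. distr \<Omega> borel (Y n) = distr M borel (T n)" "Y' \<in> measurable \<Omega> lborel"
    "distr \<Omega> borel Y' = std_normal_distribution" "\<And>\<omega>. \<omega> \<in> space \<Omega> \<Longrightarrow> (\<lambda>n. Y n \<omega>) \<longlonglongrightarrow> Y' \<omega>"
    using Skorohod[OF _ _ clt] real_distribution_distr[OF T] real_dist_normal_dist by blast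
  show thesis
  proof (rule that[of \<Omega> "\<lambda>n \<omega>. s * Y n \<omega>" "\<lambda>\<omega>. s * Y' \<omega>"])
    have Y' [measurable]: "Y' \<in> borel_measurable \<Omega>"
      using \<Omega>(4) by simp
    show "(\<lambda>\<omega>. s * Y' \<omega>) \<in> borel_measurable \<Omega>" by measurable
    show "char (distr \<Omega> borel (\<lambda>\<omega>. s * Y' \<omega>)) t = complex_of_real (exp (- (\<sigma> * t)\<^sup>2 / 2))" for t
      using Y' s(2) by (simp add: char_distr_cmult \<Omega>(5) char_std_normal_distribution power_mult_distrib)
    show "char (distr \<Omega> borel (\<lambda>\<omega>. s * Y m \<omega>)) t = char \<mu> (t / sqrt (real m)) ^ m" for m t
    proof -
      have "char (distr \<Omega> borel (\<lambda>\<omega>. s * Y m \<omega>)) t = char (distr M borel (T m)) (s * t)"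
        using \<Omega>(2) by (simp add: char_distr_cmult \<Omega>(3))
      also have "T m = (\<lambda>\<omega>. (1 / sqrt (real m * s\<^sup>2)) * (\<Sum>i<m. X i \<omega>))"
        by (simp add: T_def fun_eq_iff)
      also have "char (distr M borel \<dots>) (s * t)
          = char (distr M borel (\<lambda>\<omega>. \<Sum>i<m. X i \<omega>)) (1 / sqrt (real m * s\<^sup>2) * (s * t))"
        by (subst char_distr_cmult) simp_all
      also have "1 / sqrt (real m * s\<^sup>2) * (s * t) = t / sqrt (real m)"
        using s(1) by (simp add: real_sqrt_mult)
      also have "char (distr M borel (\<lambda>\<omega>. \<Sum>i<m. X i \<omega>)) \<dots> = char \<mu> (t / sqrt (real m)) ^ m"
        using indep_vars_subset[OF indep subset_UNIV] by (subst char_distr_sum) (auto simp: distr)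
      finally show ?thesis .
    qed
  qed (use \<Omega> in \<open>auto intro: tendsto_intros\<close>)
qed

lemma integral_iexp_PiM:
  assumes I: "finite I" and \<Omega>: "prob_space \<Omega>" and V: "\<And>i. i \<in> I \<Longrightarrow> V i \<in> borel_measurable \<Omega>"
  shows "(\<integral>\<omega>. iexp (\<Sum>i\<in>I. a i * V i (\<omega> i)) \<partial>Pi\<^sub>M I (\<lambda>_. \<Omega>))
    = (\<Prod>i\<in>I. char (distr \<Omega> borel (V i)) (a i))"
proof -
  interpret \<Omega>: prob_space \<Omega> by (rule \<Omega>)
  interpret product_sigma_finite "\<lambda>_. \<Omega>" by standard
  have "(\<integral>\<omega>. iexp (\<Sum>i\<in>I. a i * V i (\<omega> i)) \<partial>Pi\<^sub>M I (\<lambda>_. \<Omega>))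
      = (\<integral>\<omega>. (\<Prod>i\<in>I. iexp (a i * V i (\<omega> i))) \<partial>Pi\<^sub>M I (\<lambda>_. \<Omega>))"
    using I by (simp add: exp_sum sum_distrib_left)
  also have "\<dots> = (\<Prod>i\<in>I. \<integral>y. iexp (a i * V i y) \<partial>\<Omega>)"
    using I V by (intro product_integral_prod \<Omega>.integrable_iexp) auto
  also have "\<dots> = (\<Prod>i\<in>I. char (distr \<Omega> borel (V i)) (a i))"
    using V by (intro prod.cong) (auto simp: char_def integral_distr)
  finally show ?thesis .
qed

lemma continuous_on_restrict_continuous_map:
  assumes "continuous_map (product_topology (\<lambda>_. euclideanreal) I) euclideanreal f"
  shows "continuous_on UNIV (\<lambda>x. f (restrict x I))"
proof -
  have "continuous_map (product_topology (\<lambda>_. euclideanreal) UNIV)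
      (product_topology (\<lambda>_. euclideanreal) I) (\<lambda>x. restrict x I)"
    by (subst continuous_map_componentwise)
      (auto intro: continuous_map_product_projection)
  from continuous_map_compose[OF this assms] show ?thesis
    by (simp add: euclidean_product_topology o_def)
qed

text \<open>Padding with 0 sends functions on \<open>I\<close> to total functions, where continuity
  gives Borel measurability; countability of the type makes the padding measurable coordinatewise,
  and restricting to \<open>I\<close> undoes it.\<close>

lemma borel_measurable_PiM_continuous_map:
  fixes I :: "'i::countable set"
  assumes "continuous_map (product_topology (\<lambda>_. euclideanreal) I) euclideanreal f"
  shows "f \<in> borel_measurable (Pi\<^sub>M I (\<lambda>_. borel))"
proof -
  define e where "e x i = (if i \<in> I then x i else 0)" for x :: "'i \<Rightarrow> real" and i
  have "e \<in> borel_measurable (Pi\<^sub>M I (\<lambda>_. borel))"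
  proof (rule measurable_coordinatewise_then_product)
    show "(\<lambda>x. e x i) \<in> borel_measurable (Pi\<^sub>M I (\<lambda>_. borel))" for i
      by (cases "i \<in> I") (auto simp: e_def)
  qed
  from measurable_compose[OF this
      borel_measurable_continuous_onI[OF continuous_on_restrict_continuous_map[OF assms]]]
  have "(\<lambda>x. f (restrict (e x) I)) \<in> borel_measurable (Pi\<^sub>M I (\<lambda>_. borel))" .
  also have "?this \<longleftrightarrow> ?thesis"
  proof (intro measurable_cong)
    fix x :: "'i \<Rightarrow> real" assume "x \<in> space (Pi\<^sub>M I (\<lambda>_. borel))"
    hence "restrict (e x) I = x"
      by (auto simp: e_def space_PiM PiE_def extensional_def fun_eq_iff)
    thus "f (restrict (e x) I) = f x" by simp
  qed
  finally show ?thesis .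
qed

section \<open>Limit law of the isotonic regression estimator\<close>

lemma sum_indicator_eq_card:
  "(\<Sum>i=1..n::nat. indicator {x} (xs i) :: real) = real (card {i \<in> {1..n}. xs i = x})"
proof -
  have "(\<Sum>i=1..n. indicator {x} (xs i) :: real) = (\<Sum>i=1..n. if xs i = x then 1 else 0)"
    by (intro sum.cong) auto
  also have "\<dots> = (\<Sum>i\<in>{i \<in> {1..n}. xs i = x}. 1)"
    by (rule sum.inter_filter[symmetric]) simp
  finally show ?thesis by simp
qed

text \<open>Of the grid only finiteness and order enter, hence this general form. Countability of
  the type links coordinatewise and Borel measurability.\<close>

theorem isotonic_regression_converges_in_distribution:
  fixes X :: "'a::{order, countable} set"
    and g w :: "'a \<Rightarrow> real"
    and xs :: "nat \<Rightarrow> 'a"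
    and M :: "'w measure"
    and \<epsilon> Y :: "nat \<Rightarrow> 'w \<Rightarrow> real"
    and \<sigma> :: real
    and N :: "'v measure"
    and G :: "'v \<Rightarrow> 'a \<Rightarrow> real"
  assumes X: "finite X"
    and g: "mono_on X g"
    and design: "\<And>i. i \<ge> 1 \<Longrightarrow> xs i \<in> X"
    and prob: "prob_space M"
    and indep: "prob_space.indep_vars M (\<lambda>_. borel) \<epsilon> {1..}"
    and ident: "\<And>i. i \<ge> 1 \<Longrightarrow> distr M borel (\<epsilon> i) = distr M borel (\<epsilon> 1)"
    and sq_int: "\<And>i. i \<ge> 1 \<Longrightarrow> integrable M (\<lambda>\<omega>. (\<epsilon> i \<omega>)\<^sup>2)"
    and mean: "\<And>i. i \<ge> 1 \<Longrightarrow> prob_space.expectation M (\<epsilon> i) = 0"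
    and var: "\<And>i. i \<ge> 1 \<Longrightarrow> prob_space.variance M (\<epsilon> i) = \<sigma>\<^sup>2"
    and model: "\<And>i \<omega>. i \<ge> 1 \<Longrightarrow> \<omega> \<in> space M \<Longrightarrow> Y i \<omega> = g (xs i) + \<epsilon> i \<omega>"
    and weights: "\<And>x. x \<in> X \<Longrightarrow> (\<lambda>n. design_weight xs n x) \<longlonglongrightarrow> w x"
    and w_pos: "\<And>x. x \<in> X \<Longrightarrow> w x > 0"
    and gaussian: "gaussian_vector N X (\<lambda>_. 0) (limit_covariance \<sigma> w) G"
  shows "converges_in_distribution X
           M (\<lambda>n \<omega>. \<lambda>x\<in>X. sqrt (real n) *
                (isotonic_regression X (design_weight xs n)
                   (cell_mean xs (\<lambda>i. Y i \<omega>) n) x - g x))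
           N (\<lambda>\<omega>. isotonic_on_level_sets X g w (G \<omega>))"
proof -
  interpret prob_space M by (rule prob)
  let ?PX = "Pi\<^sub>M X (\<lambda>_. borel :: real measure)"
  define \<mu> where "\<mu> = distr M borel (\<epsilon> 1)"
  have \<epsilon> [measurable]: "\<epsilon> i \<in> borel_measurable M" if "i \<ge> 1" for i
    using indep that by (auto simp: indep_vars_def2)
  have ident': "distr M borel (\<epsilon> i) = \<mu>" if "i \<ge> 1" for i
    unfolding \<mu>_def using that by (rule ident)
  have indep': "indep_vars (\<lambda>_. borel) (\<lambda>i. \<epsilon> (Suc i)) UNIV"
    using indep_vars_reindex[of Suc UNIV "\<lambda>_. borel" \<epsilon>] indep_vars_subset[OF indep, of "range Suc"]
    by (auto simp: comp_def)
  have *: "expectation (\<epsilon> (Suc i)) = 0" "integrable M (\<lambda>\<omega>. (\<epsilon> (Suc i) \<omega>)\<^sup>2)"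
    "variance (\<epsilon> (Suc i)) = \<sigma>\<^sup>2" "distr M borel (\<epsilon> (Suc i)) = \<mu>" for i
    by (rule mean sq_int var ident'; simp)+
  obtain \<Omega> :: "real measure" and U U' where \<Omega>: "prob_space \<Omega>"
    and U: "\<And>m. U m \<in> borel_measurable \<Omega>" "U' \<in> borel_measurable \<Omega>"
    and U_lim: "\<And>\<omega>. \<omega> \<in> space \<Omega> \<Longrightarrow> (\<lambda>m. U m \<omega>) \<longlonglongrightarrow> U' \<omega>"
    and char_U: "\<And>m t. char (distr \<Omega> borel (U m)) t = char \<mu> (t / sqrt (real m)) ^ m"
    and char_U': "\<And>t. char (distr \<Omega> borel U') t = complex_of_real (exp (- (\<sigma> * t)\<^sup>2 / 2))"
    by (rule clt_coupling[OF indep' *]) (rule that)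
  interpret \<Omega>: prob_space \<Omega> by (rule \<Omega>)
  define \<Xi> where "\<Xi> = Pi\<^sub>M X (\<lambda>_. \<Omega>)"
  interpret \<Xi>: prob_space \<Xi>
    unfolding \<Xi>_def by (intro prob_space_PiM \<Omega>)
  have comp: "(\<lambda>\<omega>. u (\<omega> x)) \<in> borel_measurable \<Xi>" if "u \<in> borel_measurable \<Omega>" "x \<in> X" for u :: "real \<Rightarrow> real" and x
    unfolding \<Xi>_def using that by (intro measurable_PiM_component_rev)

  define cnt where "cnt n x = card {i \<in> {1..n}. xs i = x}" for n x
  have weight: "design_weight xs n x = real (cnt n x) / real n" for n x
    unfolding design_weight_def cnt_def sum_indicator_eq_card ..
  \<comment> \<open>The count is \<open>n\<close> times the design weight, so the positive limit
    \<open>w x\<close> forces it to infinity; this allows \<open>U\<close> to be followed along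
    \<open>cnt n x\<close>.\<close>
  have cnt_lim: "filterlim (\<lambda>n. cnt n x) sequentially sequentially" if x: "x \<in> X" for x
  proof -
    have "filterlim (\<lambda>n. design_weight xs n x * real n) at_top sequentially"
      by (rule filterlim_tendsto_pos_mult_at_top[OF weights[OF x] w_pos[OF x] filterlim_real_sequentially])
    moreover have "eventually (\<lambda>n. design_weight xs n x * real n = real (cnt n x)) sequentially"
      using eventually_gt_at_top[of 0] by eventually_elim (simp add: weight)
    ultimately have "filterlim (\<lambda>n. real (cnt n x)) at_top sequentially"
      using filterlim_cong by fast
    thus ?thesis
      by (simp add: filterlim_sequentially_iff_filterlim_real)
  qed
  \<comment> \<open>Before every point has been observed, some cell mean is a quotient by 0 and some
    weight vanishes; the estimator is tied to the cell errors only for good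
    \<open>n\<close>.\<close>
  define good where "good n \<longleftrightarrow> n > 0 \<and> (\<forall>x\<in>X. cnt n x > 0)" for n
  have good: "eventually good sequentially"
    unfolding good_def using X cnt_lim
    by (intro eventually_conj eventually_gt_at_top eventually_ball_finite ballI
        eventually_compose_filterlim[OF eventually_gt_at_top]) auto

  \<comment> \<open>Rescaled cell errors, their copies, and equality of the joint laws\<close>
  define V where "V n \<omega> = (\<lambda>x\<in>X. sqrt (real n) * (\<Sum>i=1..n. \<epsilon> i \<omega> * indicator {x} (xs i)) / real (cnt n x))"
    for n \<omega>
  \<comment> \<open>With \<open>m = cnt n x\<close>, \<open>sqrt n / m\<close> times a sum of
    \<open>m\<close> errors equals \<open>sqrt (n / m)\<close> times that sum divided by
    \<open>sqrt m\<close>, and the latter has the copy \<open>U m\<close>.\<close>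
  define V' where "V' n \<omega> = (\<lambda>x\<in>X. sqrt (real n / real (cnt n x)) * U (cnt n x) (\<omega> x))" for n \<omega>
  define L where "L \<omega> = (\<lambda>x\<in>X. sqrt (1 / w x) * U' (\<omega> x))" for \<omega>
  have V [measurable]: "V n \<in> M \<rightarrow>\<^sub>M ?PX" for n
    unfolding V_def
    by (intro measurable_restrict borel_measurable_divide borel_measurable_times borel_measurable_sum) auto
  have V' [measurable]: "V' n \<in> \<Xi> \<rightarrow>\<^sub>M ?PX" for n
    unfolding V'_def using U by (intro measurable_restrict borel_measurable_times comp) auto
  have L [measurable]: "L \<in> \<Xi> \<rightarrow>\<^sub>M ?PX"
    unfolding L_def using U by (intro measurable_restrict borel_measurable_times comp) auto
  have V'_lim: "(\<lambda>n. V' n \<omega> x) \<longlonglongrightarrow> L \<omega> x" if \<omega>: "\<omega> \<in> space \<Xi>" and x: "x \<in> X" for \<omega> x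
  proof -
    have "\<omega> x \<in> space \<Omega>"
      using \<omega> x by (auto simp: \<Xi>_def space_PiM)
    hence "(\<lambda>n. U (cnt n x) (\<omega> x)) \<longlonglongrightarrow> U' (\<omega> x)"
      by (intro filterlim_compose[OF U_lim cnt_lim] x)
    moreover have "(\<lambda>n. sqrt (1 / design_weight xs n x)) \<longlonglongrightarrow> sqrt (1 / w x)"
      using w_pos[OF x] by (intro tendsto_intros weights x) auto
    ultimately have "(\<lambda>n. sqrt (1 / design_weight xs n x) * U (cnt n x) (\<omega> x))
        \<longlonglongrightarrow> sqrt (1 / w x) * U' (\<omega> x)"
      by (rule tendsto_mult[rotated])
    thus ?thesis
      using x by (simp add: V'_def L_def weight)
  qed

  have law_V: "distr M ?PX (V n) = distr \<Xi> ?PX (V' n)" if n: "good n" for n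
  proof (rule measure_PiM_eqI_char[OF X])
    fix a :: "'a \<Rightarrow> real"
    \<comment> \<open>The coefficient that each error observed at \<open>x\<close> receives, so that
      the linear form becomes a sum of independent terms.\<close>
    define b where "b x = a x * sqrt (real n) / real (cnt n x)" for x
    have lin: "(\<Sum>x\<in>X. a x * V n \<omega> x) = (\<Sum>i=1..n. b (xs i) * \<epsilon> i \<omega>)" for \<omega>
    proof -
      have "a x * V n \<omega> x = (\<Sum>i=1..n. if xs i = x then b x * \<epsilon> i \<omega> else 0)" if "x \<in> X" for x
      proof -
        have "a x * V n \<omega> x = b x * (\<Sum>i=1..n. \<epsilon> i \<omega> * indicator {x} (xs i))"
          using that by (simp add: V_def b_def)
        also have "\<dots> = (\<Sum>i=1..n. if xs i = x then b x * \<epsilon> i \<omega> else 0)"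
          unfolding sum_distrib_left by (intro sum.cong) auto
        finally show ?thesis .
      qed
      hence "(\<Sum>x\<in>X. a x * V n \<omega> x) = (\<Sum>x\<in>X. \<Sum>i=1..n. if xs i = x then b x * \<epsilon> i \<omega> else 0)"
        by (rule sum.cong[OF refl])
      also have "\<dots> = (\<Sum>i=1..n. b (xs i) * \<epsilon> i \<omega>)"
        using X design by (subst sum.swap) (intro sum.cong; simp)
      finally show ?thesis .
    qed
    have "(\<integral>v. iexp (\<Sum>x\<in>X. a x * v x) \<partial>distr M ?PX (V n)) = (\<integral>\<omega>. iexp (\<Sum>i=1..n. b (xs i) * \<epsilon> i \<omega>) \<partial>M)"
      by (subst integral_distr) (auto simp: lin simp del: of_real_sum)
    also have "\<dots> = char (distr M borel (\<lambda>\<omega>. \<Sum>i\<in>{1..n}. b (xs i) * \<epsilon> i \<omega>)) 1"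
      unfolding char_def by (subst integral_distr) (auto intro!: borel_measurable_sum)
    also have "\<dots> = (\<Prod>i\<in>{1..n}. char (distr M borel (\<lambda>\<omega>. b (xs i) * \<epsilon> i \<omega>)) 1)"
    proof (rule char_distr_sum)
      have "indep_vars (\<lambda>_. borel) \<epsilon> {1..n}"
        by (rule indep_vars_subset[OF indep]) auto
      thus "indep_vars (\<lambda>_. borel) (\<lambda>i \<omega>. b (xs i) * \<epsilon> i \<omega>) {1..n}"
        by (rule indep_vars_compose2) auto
    qed
    also have "\<dots> = (\<Prod>i\<in>{1..n}. char \<mu> (b (xs i)))"
      by (intro prod.cong) (simp_all add: char_distr_cmult ident')
    \<comment> \<open>The factor of an error depends only on its cell; grouping by cells gives one
      power per cell, the shape provided by \<open>char_U\<close>.\<close>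
    also have "\<dots> = (\<Prod>x\<in>X. \<Prod>i\<in>{i \<in> {1..n}. xs i = x}. char \<mu> (b (xs i)))"
      using X design by (intro prod.group[symmetric]) auto
    also have "\<dots> = (\<Prod>x\<in>X. char \<mu> (b x) ^ cnt n x)"
      by (intro prod.cong) (auto simp: cnt_def)
    also have "\<dots> = (\<Prod>x\<in>X. char (distr \<Omega> borel (\<lambda>y. sqrt (real n / real (cnt n x)) * U (cnt n x) y)) (a x))"
    proof (intro prod.cong refl)
      fix x assume "x \<in> X"
      hence "cnt n x > 0" using n by (simp add: good_def)
      hence "sqrt (real n / real (cnt n x)) * a x / sqrt (real (cnt n x)) = b x"
        by (simp add: b_def real_sqrt_divide field_simps)
      thus "char \<mu> (b x) ^ cnt n x
          = char (distr \<Omega> borel (\<lambda>y. sqrt (real n / real (cnt n x)) * U (cnt n x) y)) (a x)"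
        using U by (simp add: char_distr_cmult char_U)
    qed
    also have "\<dots> = (\<integral>\<omega>. iexp (\<Sum>x\<in>X. a x * (sqrt (real n / real (cnt n x)) * U (cnt n x) (\<omega> x))) \<partial>\<Xi>)"
      unfolding \<Xi>_def using U X \<Omega> by (intro integral_iexp_PiM[symmetric]) auto
    also have "\<dots> = (\<integral>v. iexp (\<Sum>x\<in>X. a x * v x) \<partial>distr \<Xi> ?PX (V' n))"
      by (subst integral_distr) (auto simp: V'_def)
    finally show "(\<integral>v. iexp (\<Sum>x\<in>X. a x * v x) \<partial>distr M ?PX (V n))
        = (\<integral>v. iexp (\<Sum>x\<in>X. a x * v x) \<partial>distr \<Xi> ?PX (V' n))" .
  qed (auto intro!: prob_space_distr \<Xi>.prob_space_distr)

  have G [measurable]: "G \<in> N \<rightarrow>\<^sub>M ?PX" and N: "prob_space N"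
    and G_lin: "\<And>a. distr N borel (\<lambda>\<omega>. \<Sum>x\<in>X. a x * G \<omega> x) =
      normal_law 0 (\<Sum>x\<in>X. \<Sum>y\<in>X. a x * a y * limit_covariance \<sigma> w x y)"
    using gaussian by (auto simp: gaussian_vector_def)
  have law_G: "distr N ?PX G = distr \<Xi> ?PX L"
  proof (rule measure_PiM_eqI_char[OF X])
    fix a :: "'a \<Rightarrow> real"
    \<comment> \<open>The diagonal covariance reduces the quadratic form to \<open>v\<close>, and
      \<open>exp (- v / 2)\<close> factors over \<open>X\<close> as for independent normal
      coordinates.\<close>
    define v where "v = (\<Sum>x\<in>X. (a x)\<^sup>2 * (\<sigma>\<^sup>2 / w x))"
    have "(\<Sum>x\<in>X. \<Sum>y\<in>X. a x * a y * limit_covariance \<sigma> w x y)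
        = (\<Sum>x\<in>X. \<Sum>y\<in>X. if x = y then (a x)\<^sup>2 * (\<sigma>\<^sup>2 / w x) else 0)"
      by (intro sum.cong) (auto simp: limit_covariance_def power2_eq_square)
    also have "\<dots> = v"
      using X by (auto simp: v_def sum.delta intro!: sum.cong)
    finally have v: "(\<Sum>x\<in>X. \<Sum>y\<in>X. a x * a y * limit_covariance \<sigma> w x y) = v" .
    have "(\<integral>u. iexp (\<Sum>x\<in>X. a x * u x) \<partial>distr N ?PX G) = (\<integral>\<omega>. iexp (\<Sum>x\<in>X. a x * G \<omega> x) \<partial>N)"
      by (subst integral_distr) auto
    also have "\<dots> = char (distr N borel (\<lambda>\<omega>. \<Sum>x\<in>X. a x * G \<omega> x)) 1"
      unfolding char_def using measurable_component_singleton[of _ X "\<lambda>_. borel"]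
      by (subst integral_distr) auto
    also have "\<dots> = complex_of_real (exp (- v / 2))"
      unfolding G_lin v using w_pos
      by (subst char_normal_law) (auto simp: v_def less_imp_le intro!: sum_nonneg mult_nonneg_nonneg divide_nonneg_pos)
    also have "\<dots> = (\<Prod>x\<in>X. complex_of_real (exp (- (\<sigma> * (sqrt (1 / w x) * a x))\<^sup>2 / 2)))"
    proof -
      have "- v / 2 = (\<Sum>x\<in>X. - (\<sigma> * (sqrt (1 / w x) * a x))\<^sup>2 / 2)"
        unfolding v_def sum_negf[symmetric] sum_divide_distrib using w_pos
        by (intro sum.cong) (auto simp: power_mult_distrib real_sqrt_pow2 less_imp_le)
      thus ?thesis using X by (simp add: exp_sum)
    qed
    also have "\<dots> = (\<Prod>x\<in>X. char (distr \<Omega> borel (\<lambda>y. sqrt (1 / w x) * U' y)) (a x))"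
      using U by (simp add: char_distr_cmult char_U')
    also have "\<dots> = (\<integral>\<omega>. iexp (\<Sum>x\<in>X. a x * (sqrt (1 / w x) * U' (\<omega> x))) \<partial>\<Xi>)"
      unfolding \<Xi>_def using U X \<Omega> by (intro integral_iexp_PiM[symmetric]) auto
    also have "\<dots> = (\<integral>u. iexp (\<Sum>x\<in>X. a x * u x) \<partial>distr \<Xi> ?PX L)"
      by (subst integral_distr) (auto simp: L_def)
    finally show "(\<integral>u. iexp (\<Sum>x\<in>X. a x * u x) \<partial>distr N ?PX G)
        = (\<integral>u. iexp (\<Sum>x\<in>X. a x * u x) \<partial>distr \<Xi> ?PX L)" .
  qed (auto intro!: prob_space.prob_space_distr[OF N] \<Xi>.prob_space_distr)

  \<comment> \<open>The estimator as a deterministic map of the rescaled cell errors\<close>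
  define F where "F n v = (\<lambda>x\<in>X. sqrt (real n) *
      (isotonic_regression X (design_weight xs n) (\<lambda>x. g x + v x / sqrt (real n)) x - g x))" for n v
  define Z where "Z n \<omega> = (\<lambda>x\<in>X. sqrt (real n) * (isotonic_regression X (design_weight xs n)
      (cell_mean xs (\<lambda>i. Y i \<omega>) n) x - g x))" for n \<omega>
  have Z: "Z n \<omega> = F n (V n \<omega>)" if n: "good n" and \<omega>: "\<omega> \<in> space M" for n \<omega>
  proof -
    have "cell_mean xs (\<lambda>i. Y i \<omega>) n x = g x + V n \<omega> x / sqrt (real n)" if x: "x \<in> X" for x
    proof -
      have pos: "n > 0" "cnt n x > 0" using n x by (auto simp: good_def)
      have "(\<Sum>i=1..n. Y i \<omega> * indicator {x} (xs i))
          = (\<Sum>i=1..n. g x * indicator {x} (xs i) + \<epsilon> i \<omega> * indicator {x} (xs i))"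
        by (intro sum.cong) (auto simp: model \<omega> indicator_def)
      also have "\<dots> = g x * cnt n x + (\<Sum>i=1..n. \<epsilon> i \<omega> * indicator {x} (xs i))"
        unfolding sum.distrib sum_distrib_left[symmetric] sum_indicator_eq_card cnt_def ..
      finally show ?thesis
        using pos x unfolding cell_mean_def sum_indicator_eq_card cnt_def[symmetric]
        by (simp add: V_def field_simps)
    qed
    thus ?thesis
      unfolding Z_def F_def by (intro restrict_ext) (simp cong: isotonic_regression_cong)
  qed
  have F [measurable]: "F n \<in> ?PX \<rightarrow>\<^sub>M ?PX" if n: "good n" for n
    unfolding F_def using n
    by (intro measurable_restrict borel_measurable_times borel_measurable_diff
        borel_measurable_isotonic_regression X borel_measurable_add borel_measurable_divide)
      (auto simp: good_def weight)
  define H where "H = isotonic_on_level_sets X g w"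
  have H [measurable]: "H \<in> ?PX \<rightarrow>\<^sub>M ?PX"
    unfolding H_def isotonic_on_level_sets_def
  proof (intro measurable_restrict)
    fix x assume x: "x \<in> X"
    let ?C = "comparable_level_set X g x"
    have "?C \<subseteq> X" using comparable_level_set_subset[OF x] by blast
    thus "(\<lambda>v. isotonic_regression ?C w v x) \<in> borel_measurable ?PX"
      using X w_pos comparable_level_set_refl
      by (intro borel_measurable_isotonic_regression) (auto intro: finite_subset)
  qed
  have F_lim: "(\<lambda>n. F n (V' n \<omega>) x) \<longlonglongrightarrow> H (L \<omega>) x" if "\<omega> \<in> space \<Xi>" "x \<in> X" for \<omega> x
    using tendsto_scaled_isotonic_regression[OF X g w_pos weights V'_lim[OF that(1)]
        filterlim_compose[OF sqrt_at_top filterlim_real_sequentially] that(2)] that(2)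
    by (simp add: F_def H_def)

  \<comment> \<open>Convergence of the integrals of test functions\<close>
  have "(\<lambda>n. \<integral>\<omega>. f (Z n \<omega>) \<partial>M) \<longlonglongrightarrow> (\<integral>\<omega>. f (H (G \<omega>)) \<partial>N)"
    if f: "continuous_map (product_topology (\<lambda>_. euclideanreal) X) euclideanreal f"
      and bounded: "bounded (f ` (\<Pi>\<^sub>E i\<in>X. UNIV))" for f :: "('a \<Rightarrow> real) \<Rightarrow> real"
  proof -
    have f_meas [measurable]: "f \<in> borel_measurable ?PX"
      by (rule borel_measurable_PiM_continuous_map[OF f])
    obtain B where B: "\<And>v. v \<in> extensional X \<Longrightarrow> norm (f v) \<le> B"
      using bounded by (auto simp: bounded_iff PiE_def)
    obtain n0 where n0: "\<And>n. n \<ge> n0 \<Longrightarrow> good n"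
      using good by (auto simp: eventually_sequentially)
    \<comment> \<open>Dominated convergence asks for measurability at every index, so the sequence
      is started at \<open>n0\<close>, from where on all \<open>n\<close> are good.\<close>
    have "(\<lambda>n. \<integral>\<omega>. f (F (n + n0) (V' (n + n0) \<omega>)) \<partial>\<Xi>) \<longlonglongrightarrow> (\<integral>\<omega>. f (H (L \<omega>)) \<partial>\<Xi>)"
    proof (rule integral_dominated_convergence[where w = "\<lambda>_. B"])
      show "AE \<omega> in \<Xi>. (\<lambda>n. f (F (n + n0) (V' (n + n0) \<omega>))) \<longlonglongrightarrow> f (H (L \<omega>))"
      proof (intro AE_I2)
        fix \<omega> assume \<omega>: "\<omega> \<in> space \<Xi>"
        have "limitin (product_topology (\<lambda>_. euclideanreal) X) (\<lambda>n. F n (V' n \<omega>)) (H (L \<omega>)) sequentially"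
          using F_lim[OF \<omega>] by (auto simp: limitin_componentwise F_def H_def isotonic_on_level_sets_def)
        from continuous_map_limit[OF f this]
        have "(\<lambda>n. f (F n (V' n \<omega>))) \<longlonglongrightarrow> f (H (L \<omega>))"
          by (simp add: o_def)
        thus "(\<lambda>n. f (F (n + n0) (V' (n + n0) \<omega>))) \<longlonglongrightarrow> f (H (L \<omega>))"
          by (rule LIMSEQ_ignore_initial_segment)
      qed
      show "(\<lambda>\<omega>. f (F (n + n0) (V' (n + n0) \<omega>))) \<in> borel_measurable \<Xi>" for n
        using F[OF n0[of "n + n0"]] by measurable
      show "AE \<omega> in \<Xi>. norm (f (F (n + n0) (V' (n + n0) \<omega>))) \<le> B" for n
        by (intro AE_I2 B) (simp add: F_def)
    qed auto
    hence "(\<lambda>n. \<integral>\<omega>. f (F n (V' n \<omega>)) \<partial>\<Xi>) \<longlonglongrightarrow> (\<integral>\<omega>. f (H (L \<omega>)) \<partial>\<Xi>)"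
      by (rule LIMSEQ_offset)
    moreover have "(\<integral>\<omega>. f (H (L \<omega>)) \<partial>\<Xi>) = (\<integral>\<omega>. f (H (G \<omega>)) \<partial>N)"
    proof -
      have "(\<integral>\<omega>. f (H (L \<omega>)) \<partial>\<Xi>) = (\<integral>v. f (H v) \<partial>distr \<Xi> ?PX L)"
        by (subst integral_distr) auto
      also have "\<dots> = (\<integral>\<omega>. f (H (G \<omega>)) \<partial>N)"
        unfolding law_G[symmetric] by (subst integral_distr) auto
      finally show ?thesis .
    qed
    \<comment> \<open>The estimator and its copy live on different spaces; equality of the laws of
      \<open>V n\<close> and \<open>V' n\<close> carries the integral from one to the other.\<close>
    moreover have "eventually (\<lambda>n. (\<integral>\<omega>. f (F n (V' n \<omega>)) \<partial>\<Xi>) = (\<integral>\<omega>. f (Z n \<omega>) \<partial>M)) sequentially"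
      using good
    proof eventually_elim
      case (elim n)
      have [measurable]: "F n \<in> ?PX \<rightarrow>\<^sub>M ?PX" by (rule F[OF elim])
      have "(\<integral>\<omega>. f (F n (V' n \<omega>)) \<partial>\<Xi>) = (\<integral>v. f (F n v) \<partial>distr \<Xi> ?PX (V' n))"
        by (subst integral_distr) auto
      also have "\<dots> = (\<integral>\<omega>. f (F n (V n \<omega>)) \<partial>M)"
        unfolding law_V[OF elim, symmetric] by (subst integral_distr) auto
      also have "\<dots> = (\<integral>\<omega>. f (Z n \<omega>) \<partial>M)"
        by (intro Bochner_Integration.integral_cong refl) (simp add: Z elim)
      finally show ?case .
    qed
    ultimately show ?thesis
      by (auto intro: Lim_transform_eventually)
  qed
  moreover have "eventually (\<lambda>n. Z n \<in> M \<rightarrow>\<^sub>M ?PX) sequentially"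
    using good
  proof eventually_elim
    case (elim n)
    have "(\<lambda>\<omega>. F n (V n \<omega>)) \<in> M \<rightarrow>\<^sub>M ?PX"
      by (rule measurable_compose[OF V F[OF elim]])
    thus ?case
      by (subst measurable_cong[OF Z[OF elim]])
  qed
  moreover have "(\<lambda>\<omega>. H (G \<omega>)) \<in> N \<rightarrow>\<^sub>M ?PX" by measurable
  ultimately show ?thesis
    unfolding converges_in_distribution_def Z_def H_def by blast
qed

lemma finite_grid: "finite (grid r)"
proof -
  have "grid r \<subseteq> vec_lambda ` (\<Pi>\<^sub>E j\<in>UNIV. {1..r $ j})"
  proof
    fix x assume "x \<in> grid r"
    hence "vec_nth x \<in> (\<Pi>\<^sub>E j\<in>UNIV. {1..r $ j})" by (auto simp: grid_def)
    thus "x \<in> vec_lambda ` (\<Pi>\<^sub>E j\<in>UNIV. {1..r $ j})"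
      by (rule rev_image_eqI) simp
  qed
  thus ?thesis
    by (rule finite_subset) (intro finite_imageI finite_PiE; simp)
qed

theorem corollary1:
  fixes r :: "nat ^ 'd"
    and g w :: "nat ^ 'd \<Rightarrow> real"
    and xs :: "nat \<Rightarrow> nat ^ 'd"
    and M :: "'w measure"
    and \<epsilon> Y :: "nat \<Rightarrow> 'w \<Rightarrow> real"
    and \<sigma> :: real
    and N :: "'v measure"
    and G :: "'v \<Rightarrow> nat ^ 'd \<Rightarrow> real"
  assumes g_isotonic: "mono_on (grid r) g"
    and design: "\<And>i. i \<ge> 1 \<Longrightarrow> xs i \<in> grid r"
    and prob: "prob_space M"
    and indep: "prob_space.indep_vars M (\<lambda>_. borel) \<epsilon> {1..}"
    and ident: "\<And>i. i \<ge> 1 \<Longrightarrow> distr M borel (\<epsilon> i) = distr M borel (\<epsilon> 1)"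
    and sq_int: "\<And>i. i \<ge> 1 \<Longrightarrow> integrable M (\<lambda>\<omega>. (\<epsilon> i \<omega>)\<^sup>2)"
    and mean: "\<And>i. i \<ge> 1 \<Longrightarrow> prob_space.expectation M (\<epsilon> i) = 0"
    and var: "\<And>i. i \<ge> 1 \<Longrightarrow> prob_space.variance M (\<epsilon> i) = \<sigma>\<^sup>2"
    and model: "\<And>i \<omega>. i \<ge> 1 \<Longrightarrow> \<omega> \<in> space M \<Longrightarrow> Y i \<omega> = g (xs i) + \<epsilon> i \<omega>"
    and weights: "\<And>x. x \<in> grid r \<Longrightarrow> (\<lambda>n. design_weight xs n x) \<longlonglongrightarrow> w x"
    and w_pos: "\<And>x. x \<in> grid r \<Longrightarrow> w x > 0"
    and gaussian: "gaussian_vector N (grid r) (\<lambda>_. 0) (limit_covariance \<sigma> w) G"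
  shows "converges_in_distribution (grid r)
           M (\<lambda>n \<omega>. \<lambda>x\<in>grid r. sqrt (real n) *
                (isotonic_regression (grid r) (design_weight xs n)
                   (cell_mean xs (\<lambda>i. Y i \<omega>) n) x - g x))
           N (\<lambda>\<omega>. isotonic_on_level_sets (grid r) g w (G \<omega>))"
  using finite_grid assms by (rule isotonic_regression_converges_in_distribution)

end
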